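(* There is a comeager set $\mathcal{X}_{li}\subset\mathcal{G}_{li}$ such that each $G\in\mathcal{X}_{li}$ satisfies: (1) $G$ is not biorderable. (2) $G$ does not admit nontrivial actions by $C^1$-diffeomorphisms on the closed interval, $[0,1)$ or the circle.
   Context: An enumerated group is a group whose underlying set is $\mathbf{N}=\{1,2,3,\ldots\}$. The set $\mathcal{G}$ of enumerated groups is identified, via (multiplication, inversion, identity), with a subset of $\mathbf{N}^{\mathbf{N}\times\mathbf{N}}\times\mathbf{N}^{\mathbf{N}}\times\mathbf{N}$ (product topology, $\mathbf{N}$ discrete) and given the subspace topology; it is a Polish space. $\mathcal{G}_{li}\subset\mathcal{G}$ is the subspace of locally indicable enumerated groups, i.e. those in which every nontrivial finitely generated subgroup has an infinite cyclic quotient. A subset is comeager if it contains a countable intersection of dense open subsets of the space. A group is biorderable if it admits a total order invariant under both left and right translation. *)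

theory Defs
  imports "HOL-Analysis.Analysis" "HOL-Algebra.Group_Action" "HOL-Algebra.Elementary_Groups"
begin

text \<open>
  A point of the ambient space is a triple (multiplication, inversion, identity). The underlying
  set of every enumerated group is the whole type \<open>nat\<close>, so its elements are labelled 0, 1, 2, ...
  instead of 1, 2, 3, ...; the shift is a homeomorphism and nothing depends on the labels.
  The type-class topology of the type below is the product topology with \<open>nat\<close> discrete.
\<close>

type_synonym group_ops = "(nat \<times> nat \<Rightarrow> nat) \<times> (nat \<Rightarrow> nat) \<times> nat"

definition group_of_ops :: "group_ops \<Rightarrow> nat monoid" where
  "group_of_ops = (\<lambda>(m, i, e). \<lparr>carrier = UNIV, monoid.mult = (\<lambda>x y. m (x, y)), one = e\<rparr>)"

definition enumerated_groups :: "group_ops set" where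
  "enumerated_groups =
     {(m, i, e). group (group_of_ops (m, i, e)) \<and> (\<forall>x. i x = inv\<^bsub>group_of_ops (m, i, e)\<^esub> x)}"

definition locally_indicable :: "('a, 'b) monoid_scheme \<Rightarrow> bool" where
  "locally_indicable G \<longleftrightarrow>
     (\<forall>S. finite S \<and> S \<subseteq> carrier G \<and> \<not> trivial_group (subgroup_generated G S) \<longrightarrow>
        (\<exists>N. N \<lhd> subgroup_generated G S \<and>
             cyclic_group (subgroup_generated G S Mod N) \<and>
             infinite (carrier (subgroup_generated G S Mod N))))"

definition li_enumerated_groups :: "group_ops set" where
  "li_enumerated_groups = {p \<in> enumerated_groups. locally_indicable (group_of_ops p)}"

definition comeager_in :: "'a topology \<Rightarrow> 'a set \<Rightarrow> bool" where
  "comeager_in T X \<longleftrightarrow> X \<subseteq> topspace T \<and>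
     (\<exists>U :: nat \<Rightarrow> 'a set.
        (\<forall>n. openin T (U n) \<and> Abstract_Topology.closure_of T (U n) = topspace T) \<and> (\<Inter>n. U n) \<subseteq> X)"

definition biorderable :: "('a, 'b) monoid_scheme \<Rightarrow> bool" where
  "biorderable G \<longleftrightarrow>
     (\<exists>r. linear_order_on (carrier G) r \<and>
        (\<forall>a\<in>carrier G. \<forall>b\<in>carrier G. \<forall>c\<in>carrier G. (a, b) \<in> r \<longrightarrow>
           (c \<otimes>\<^bsub>G\<^esub> a, c \<otimes>\<^bsub>G\<^esub> b) \<in> r \<and> (a \<otimes>\<^bsub>G\<^esub> c, b \<otimes>\<^bsub>G\<^esub> c) \<in> r))"

text \<open>
  The predicate \<open>C1_differentiable_on\<close> uses two-sided derivatives at every point; on an interval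
  containing an endpoint the derivative has to be taken within the interval.
\<close>

definition C1_within :: "real set \<Rightarrow> (real \<Rightarrow> real) \<Rightarrow> bool" where
  "C1_within I f \<longleftrightarrow>
     (\<exists>f'. (\<forall>x\<in>I. (f has_real_derivative f' x) (at x within I)) \<and> continuous_on I f')"

definition C1_diffeo_interval :: "real set \<Rightarrow> (real \<Rightarrow> real) \<Rightarrow> bool" where
  "C1_diffeo_interval I f \<longleftrightarrow> bij_betw f I I \<and> C1_within I f \<and> C1_within I (inv_into I f)"

text \<open>
  The circle is the unit circle of the complex plane, an embedded submanifold with local
  parametrization \<open>cis\<close>; hence a self-map f of it is continuously differentiable
  iff \<open>f \<circ> cis\<close> is so as a map from the reals to the complex plane.
\<close>

abbreviation unit_circle :: "complex set" where
  "unit_circle \<equiv> sphere 0 1"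

definition C1_diffeo_circle :: "(complex \<Rightarrow> complex) \<Rightarrow> bool" where
  "C1_diffeo_circle f \<longleftrightarrow> bij_betw f unit_circle unit_circle \<and>
     (f \<circ> cis) C1_differentiable_on UNIV \<and>
     (inv_into unit_circle f \<circ> cis) C1_differentiable_on UNIV"

definition has_nontrivial_action_by ::
    "('a, 'b) monoid_scheme \<Rightarrow> 'c set \<Rightarrow> (('c \<Rightarrow> 'c) \<Rightarrow> bool) \<Rightarrow> bool" where
  "has_nontrivial_action_by G M P \<longleftrightarrow>
     (\<exists>\<phi>. group_action G M \<phi> \<and> (\<forall>g\<in>carrier G. P (\<phi> g)) \<and>
        (\<exists>g\<in>carrier G. \<exists>x\<in>M. \<phi> g x \<noteq> x))"

end

theory Submission
  imports Defs "HOL-Algebra.Multiplicative_Group"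
begin

text \<open>
  Call an element \<open>g\<close> of a group obstructed if there are \<open>v\<close>, \<open>x\<close>, \<open>b\<close>, \<open>f\<close> such that
  \<open>s = v\<^sup>2\<close>, \<open>w = x\<^sup>2\<close>, \<open>t = w\<^sup>2\<close>, \<open>c = b\<^sup>2\<close> and \<open>h = c\<^sup>3\<close> satisfy
  \<open>s x s\<^sup>-\<^sup>1 = x\<^sup>-\<^sup>1\<close>, \<open>t b t\<^sup>-\<^sup>1 = b\<^sup>-\<^sup>2\<close> and \<open>g = [f, h] = f h f\<^sup>-\<^sup>1 h\<^sup>-\<^sup>1\<close>
  (\<open>smooth_obstruction\<close>); the first two relations then also hold for the powers \<open>w\<close>, \<open>t\<close> of \<open>x\<close> and
  \<open>c\<close>, \<open>h\<close> of \<open>b\<close>. The comeager set consists of the locally indicable enumerated groups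
  all of whose elements are obstructed. Two facts make this work: obstructed elements act trivially
  in every action at issue, and every element of a locally indicable group becomes obstructed in a
  larger locally indicable group.

  Since \<open>g = [f, h]\<close>, it suffices for the first fact that \<open>h\<close> acts trivially. The elements
  \<open>s\<close>, \<open>w\<close>, \<open>c\<close> and \<open>h\<close> are squares, so they preserve orientation. The core is
  \<open>inverse_square_relation_imp_trivial\<close>: increasing \<open>C\<^sup>1\<close> diffeomorphisms \<open>h\<close>, \<open>t\<close> of a compact
  interval with \<open>t h t\<^sup>-\<^sup>1 = h\<^sup>-\<^sup>2\<close> satisfy \<open>h = id\<close>. The negative exponent forces \<open>t\<close> to move every
  point \<open>y\<close> that \<open>h\<close> moves, so \<open>y\<^sub>n = t\<^sup>-\<^sup>n y\<close> converges to a common fixed point, where \<open>h\<close> has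
  derivative 1. As the derivative of \<open>t\<^sup>-\<^sup>1\<close> is continuous there, it scales the displacements
  \<open>\<bar>h y\<^sub>n - y\<^sub>n\<bar>\<close> and the steps \<open>\<bar>y\<^sub>n\<^sub>+\<^sub>1 - y\<^sub>n\<bar>\<close> by almost the same factor, but the square makes the
  displacements gain a further factor of almost 2. Hence the displacements eventually exceed the
  steps. On the other hand \<open>h\<close> moves \<open>y\<^sub>n\<close> and \<open>y\<^sub>n\<^sub>+\<^sub>1\<close> in opposite directions, which keeps every
  second displacement below the step. To reduce the half-open interval and the circle to the compact
  case one needs fixed points of \<open>t\<close>, and these come from \<open>s t s\<^sup>-\<^sup>1 = t\<^sup>-\<^sup>1\<close>: conjugation by an increasing
  map cannot turn a map above the identity into one below it
  (\<open>fixed_point_beyond_if_conjugate_to_inverse\<close>). On the circle one first lifts to the line; the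
  relations then hold up to integer periods, and passing from \<open>w\<close>, \<open>c\<close> to \<open>w\<^sup>2\<close>, \<open>c\<^sup>3\<close> leaves just
  enough room to remove these by translation. Non-biorderability is a by-product: if \<open>g \<noteq> 1\<close> then
  \<open>b \<noteq> 1\<close>, and \<open>b\<^sup>2 t b = t\<close> makes both signs of \<open>b\<close> impossible (\<open>biorderable_obstruction\<close>).

  For the second fact everything is found in unrestricted wreath products, which preserve local
  indicability because a finitely generated subgroup either maps nontrivially to the top group or
  lies in the base, where some coordinate is nontrivial. In \<open>\<int> wr \<int>\<close> there are
  suitable \<open>v\<close> and \<open>x\<close>, in \<open>A = \<rat> wr (\<int> wr \<int>)\<close> there is a suitable \<open>b\<close> for which \<open>h\<close> has
  infinite order, and in \<open>G wr A\<close> the copy of \<open>g \<in> G\<close> supported at \<open>1 \<in> A\<close> is \<open>[f, h]\<close> for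
  the function \<open>f\<close> that is \<open>g\<close> on \<open>{h\<^sup>n | n \<ge> 0}\<close> and trivial elsewhere. Enumerating a countable subgroup of
  \<open>G wr A\<close> so that a given finite part of \<open>G\<close> keeps its labels shows that the open condition
  ``\<open>g\<close> is obstructed'' is dense (\<open>obstruction_dense\<close>).
\<close>

section \<open>A rigidity property of \<open>C\<^sup>1\<close> diffeomorphisms of an interval\<close>

lemma deriv_bounds_imp_difference_bounds:
  fixes f f' :: "real \<Rightarrow> real"
  assumes der: "\<And>x. x \<in> {p..q} \<Longrightarrow> (f has_real_derivative f' x) (at x within {p..q})"
    and bounds: "\<And>x. x \<in> {p..q} \<Longrightarrow> \<bar>x - z\<bar> < r \<Longrightarrow> l \<le> f' x \<and> f' x \<le> m"
    and ab: "a \<in> {p..q}" "b \<in> {p..q}" "\<bar>a - z\<bar> < r" "\<bar>b - z\<bar> < r" and "0 \<le> l"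
  shows "l * \<bar>a - b\<bar> \<le> \<bar>f a - f b\<bar> \<and> \<bar>f a - f b\<bar> \<le> m * \<bar>a - b\<bar>"
proof -
  have *: "l * (b - a) \<le> \<bar>f b - f a\<bar> \<and> \<bar>f b - f a\<bar> \<le> m * (b - a)"
    if less: "a < b" and ab: "a \<in> {p..q}" "b \<in> {p..q}" "\<bar>a - z\<bar> < r" "\<bar>b - z\<bar> < r" for a b
  proof -
    have "(f has_derivative (*) (f' x)) (at x within {a..b})" if "a \<le> x" "x \<le> b" for x
      using der[of x] that ab DERIV_subset[of f "f' x" x "{p..q}" "{a..b}"]
      by (auto simp: has_field_derivative_def)
    from mvt_simple[OF less this]
    obtain x where x: "x \<in> {a<..<b}" "f b - f a = f' x * (b - a)" by blast
    have "l \<le> f' x \<and> f' x \<le> m" using x ab by (intro bounds) auto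
    then show ?thesis
      using less \<open>0 \<le> l\<close> by (simp add: x(2) abs_mult mult_right_mono)
  qed
  show ?thesis
  proof (cases a b rule: linorder_cases)
    case less
    then show ?thesis using *[of a b] ab by (simp add: abs_minus_commute)
  next
    case equal
    then show ?thesis by simp
  next
    case greater
    then show ?thesis using *[of b a] ab by (simp add: abs_minus_commute)
  qed
qed

text \<open>
  Here \<open>gi\<close> is the inverse of \<open>g\<close>, and \<open>u\<close> stands for \<open>t\<^sup>-\<^sup>1\<close> when \<open>t g t\<^sup>-\<^sup>1 = g\<^sup>-\<^sup>2\<close>. The proof compares, along
  an orbit \<open>y n\<close> of \<open>u\<close>, the displacement \<open>\<delta> n\<close> of \<open>g\<close> with the step \<open>\<epsilon> n\<close> of the orbit: their ratio
  grows geometrically near the limit of the orbit, although it is below 1 for every second \<open>n\<close>.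
\<close>

lemma inverse_square_relation_imp_trivial:
  fixes g gi u gi' u' :: "real \<Rightarrow> real"
  assumes maps: "\<And>x. x \<in> {p..q} \<Longrightarrow> g x \<in> {p..q} \<and> gi x \<in> {p..q} \<and> u x \<in> {p..q}"
    and mono: "strict_mono_on {p..q} g" "strict_mono_on {p..q} u"
    and inv: "\<And>x. x \<in> {p..q} \<Longrightarrow> g (gi x) = x \<and> gi (g x) = x"
    and rel: "\<And>x. x \<in> {p..q} \<Longrightarrow> g (u x) = u (gi (gi x))"
    and contg: "continuous_on {p..q} g"
    and der_gi: "\<And>x. x \<in> {p..q} \<Longrightarrow> (gi has_real_derivative gi' x) (at x within {p..q})"
      "continuous_on {p..q} gi'"
    and der_u: "\<And>x. x \<in> {p..q} \<Longrightarrow> (u has_real_derivative u' x) (at x within {p..q})"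
      "continuous_on {p..q} u'" "\<And>x. x \<in> {p..q} \<Longrightarrow> 0 < u' x"
    and x: "x \<in> {p..q}"
  shows "g x = x"
proof (rule ccontr)
  assume gx: "g x \<noteq> x"
  define I where "I = {p..q}"
  have less_g: "g a < g b \<longleftrightarrow> a < b" and less_u: "u a < u b \<longleftrightarrow> a < b"
    if "a \<in> I" "b \<in> I" for a b
    using that mono strict_mono_on_less[of I] by (auto simp: I_def)
  have less_gi: "gi a < gi b \<longleftrightarrow> a < b" if "a \<in> I" "b \<in> I" for a b
    using that less_g[of "gi a" "gi b"] inv maps by (auto simp: I_def)
  note maps = maps[folded I_def] and inv = inv[folded I_def] and rel = rel[folded I_def]
  have gi_gt: "gi a > a \<longleftrightarrow> g a < a" and gi_lt: "gi a < a \<longleftrightarrow> g a > a" if "a \<in> I" for a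
    using less_g[of "gi a" a] less_g[of a "gi a"] that inv maps by auto
  \<comment> \<open>The relation makes \<open>u\<close> exchange the points that \<open>g\<close> moves up and those it moves down.\<close>
  have up: "g (u a) < u a" if "a \<in> I" "g a > a" for a
    using that gi_lt[of a] less_gi[of "gi a" a] less_u[of "gi (gi a)" a] maps rel[of a] by auto
  have down: "g (u a) > u a" if "a \<in> I" "g a < a" for a
    using that gi_gt[of a] less_gi[of a "gi a"] less_u[of a "gi (gi a)"] maps rel[of a] by auto
  have fixed: "g a = a" if "a \<in> I" "u a = a" for a
    using up[of a] down[of a] that by fastforce
  have xI: "x \<in> I" using x by (simp add: I_def)
  have ux: "u x \<noteq> x" using fixed xI gx by blast

  \<comment> \<open>A fixed point of \<open>u\<close> is fixed by \<open>g\<close>, so \<open>u\<close> moves \<open>x\<close> and its orbit is strictly monotone.\<close>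
  define y where "y n = (u ^^ n) x" for n
  have y0: "y 0 = x" and ySuc: "y (Suc n) = u (y n)" for n by (simp_all add: y_def)
  have yI: "y n \<in> I" for n by (induction n) (auto simp: y0 ySuc xI maps)
  have g_y: "g (y n) \<noteq> y n" for n
  proof (induction n)
    case 0
    then show ?case using gx by (simp add: y0)
  next
    case (Suc n)
    then show ?case using up[OF yI, of n] down[OF yI, of n] by (auto simp: ySuc neq_iff)
  qed
  have y_incr: "y n < y (Suc n)" if "x < u x" for n
    by (induction n) (simp_all add: that less_u yI y0 ySuc maps)
  have y_decr: "y (Suc n) < y n" if "u x < x" for n
    by (induction n) (simp_all add: that less_u yI y0 ySuc maps)
  have "Bseq y"
  proof (intro BseqI'[of _ "\<bar>p\<bar> + \<bar>q\<bar>"])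
    show "norm (y n) \<le> \<bar>p\<bar> + \<bar>q\<bar>" for n
      using yI[of n] unfolding I_def atLeastAtMost_iff real_norm_def by linarith
  qed
  moreover have "monoseq y"
    using ux y_incr y_decr by (metis linorder_neqE_linordered_idom monoseq_Suc less_imp_le)
  ultimately have "convergent y" by (rule Bseq_monoseq_convergent)
  then obtain z where z: "y \<longlonglongrightarrow> z" by (auto simp: convergent_def)
  have zI: "z \<in> I"
    using yI by (auto simp: I_def intro: Lim_bounded[OF z] Lim_bounded2[OF z])
  have contu: "continuous_on I u" and contgi: "continuous_on I gi"
    unfolding I_def using DERIV_continuous_on[OF der_gi(1)] DERIV_continuous_on[OF der_u(1)] by auto
  have seq: "(\<lambda>n. f (s n)) \<longlonglongrightarrow> f z"
    if "continuous_on I f" "s \<longlonglongrightarrow> z" "\<And>n. s n \<in> I" for f s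
    using that zI continuous_on_tendsto_compose[of I f s z sequentially] by auto
  have lim_u: "(\<lambda>n. u (y n)) \<longlonglongrightarrow> u z" by (rule seq[OF contu z yI])
  have "u z = z"
    using lim_u LIMSEQ_Suc[OF z] LIMSEQ_unique by (auto simp: ySuc)
  then have gz: "g z = z" using fixed zI by blast
  then have giz: "gi z = z" using inv[OF zI] by simp
  have "p < q" using ux xI maps[OF xI] by (auto simp: I_def)

  \<comment> \<open>Comparing derivatives in \<open>gi \<circ> u \<circ> gi \<circ> gi = u\<close> at the common fixed point \<open>z\<close>.\<close>
  have "gi' z = 1"
  proof -
    have dgi: "(gi has_real_derivative gi' z) (at z within I)"
      and du: "(u has_real_derivative u' z) (at z within I)"
      using der_gi(1) der_u(1) zI by (auto simp: I_def)
    have chain: "((\<lambda>x. f (h x)) has_real_derivative a * b) (at z within I)"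
      if "(f has_real_derivative a) (at z within I)" "(h has_real_derivative b) (at z within I)"
        "h z = z" "h ` I \<subseteq> I" for f h a b
      using DERIV_image_chain[of f a h z I b] that DERIV_subset[of f a z I "h ` I"]
      by (simp add: o_def)
    have "((\<lambda>x. gi (u (gi (gi x)))) has_real_derivative gi' z * (u' z * (gi' z * gi' z))) (at z within I)"
      using maps giz \<open>u z = z\<close> by (intro chain dgi du) auto
    moreover have "((\<lambda>x. gi (u (gi (gi x)))) has_real_derivative u' z) (at z within I)"
      by (rule has_field_derivative_transform_within[OF du zero_less_one zI]) (metis rel inv maps)
    moreover have "at z within I \<noteq> bot"
      using zI \<open>p < q\<close> by (metis I_def atLeastAtMost_iff islimpt_Icc trivial_limit_within)
    ultimately have "gi' z * (u' z * (gi' z * gi' z)) = u' z"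
      using has_field_derivative_unique by blast
    then have "gi' z ^ 3 = 1"
      using der_u(3)[of z] zI by (auto simp: I_def power3_eq_cube)
    moreover have "root 3 (gi' z ^ 3) = gi' z" by (rule odd_real_root_power_cancel) simp
    ultimately show ?thesis by simp
  qed

  define l where "l = u' z"
  have "l > 0" using der_u(3) zI by (simp add: l_def I_def)
  have "\<exists>d>0. \<forall>a\<in>I. \<bar>a - z\<bar> < d \<longrightarrow> \<bar>gi' a - 1\<bar> < 1/10"
    using der_gi(2)[unfolded continuous_on_iff, folded I_def, rule_format, OF zI, of "1/10"]
    by (auto simp: dist_real_def \<open>gi' z = 1\<close>)
  then obtain d1 where d1: "d1 > 0" "\<And>a. a \<in> I \<Longrightarrow> \<bar>a - z\<bar> < d1 \<Longrightarrow> \<bar>gi' a - 1\<bar> < 1/10"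
    by blast
  have "\<exists>d>0. \<forall>a\<in>I. \<bar>a - z\<bar> < d \<longrightarrow> \<bar>u' a - l\<bar> < l / 10"
    using der_u(2)[unfolded continuous_on_iff, folded I_def, rule_format, OF zI, of "l/10"] \<open>l > 0\<close>
    by (auto simp: dist_real_def l_def)
  then obtain d2 where d2: "d2 > 0" "\<And>a. a \<in> I \<Longrightarrow> \<bar>a - z\<bar> < d2 \<Longrightarrow> \<bar>u' a - l\<bar> < l / 10"
    by blast
  define d where "d = min d1 d2"
  have "d > 0" using d1 d2 by (simp add: d_def)
  have near_gi: "9/10 * \<bar>a - b\<bar> \<le> \<bar>gi a - gi b\<bar>"
    if "a \<in> I" "b \<in> I" "\<bar>a - z\<bar> < d" "\<bar>b - z\<bar> < d" for a b
  proof -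
    have "9/10 \<le> gi' c \<and> gi' c \<le> 11/10" if "c \<in> {p..q}" "\<bar>c - z\<bar> < d" for c
      using d1(2)[of c] that unfolding I_def d_def abs_less_iff by (simp add: field_simps)
    from deriv_bounds_imp_difference_bounds[OF der_gi(1) this, where a = a and b = b] that show ?thesis
      by (simp add: I_def)
  qed
  have near_u: "9/10 * l * \<bar>a - b\<bar> \<le> \<bar>u a - u b\<bar> \<and> \<bar>u a - u b\<bar> \<le> 11/10 * l * \<bar>a - b\<bar>"
    if "a \<in> I" "b \<in> I" "\<bar>a - z\<bar> < d" "\<bar>b - z\<bar> < d" for a b
  proof -
    have "9/10 * l \<le> u' c \<and> u' c \<le> 11/10 * l" if "c \<in> {p..q}" "\<bar>c - z\<bar> < d" for c
      using d2(2)[of c] that unfolding I_def d_def abs_less_iff by (simp add: field_simps)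
    from deriv_bounds_imp_difference_bounds[OF der_u(1) this, where a = a and b = b] that \<open>l > 0\<close> show ?thesis
      by (simp add: I_def)
  qed

  have near: "\<exists>N. \<forall>n\<ge>N. \<bar>s n - z\<bar> < d" if "s \<longlonglongrightarrow> z" for s
    using LIMSEQ_D[OF that \<open>d > 0\<close>] by simp
  have giI: "gi (y n) \<in> I" for n using maps yI by blast
  have lim_g: "(\<lambda>n. g (y n)) \<longlonglongrightarrow> z"
    using seq[OF contg[folded I_def] z yI] by (simp add: gz)
  have lim_gi: "(\<lambda>n. gi (y n)) \<longlonglongrightarrow> z" using seq[OF contgi z yI] by (simp add: giz)
  have lim_gi2: "(\<lambda>n. gi (gi (y n))) \<longlonglongrightarrow> z"
    using seq[OF contgi lim_gi giI] by (simp add: giz)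
  obtain N1 N2 N3 N4 where N:
    "\<And>n. n \<ge> N1 \<Longrightarrow> \<bar>y n - z\<bar> < d" "\<And>n. n \<ge> N2 \<Longrightarrow> \<bar>g (y n) - z\<bar> < d"
    "\<And>n. n \<ge> N3 \<Longrightarrow> \<bar>gi (y n) - z\<bar> < d" "\<And>n. n \<ge> N4 \<Longrightarrow> \<bar>gi (gi (y n)) - z\<bar> < d"
    using near[OF z] near[OF lim_g] near[OF lim_gi] near[OF lim_gi2] by metis
  define N where "N = Max {N1, N2, N3, N4}"

  define \<delta> where "\<delta> n = \<bar>g (y n) - y n\<bar>" for n
  define \<epsilon> where "\<epsilon> n = \<bar>y (Suc n) - y n\<bar>" for n
  have \<epsilon>_pos: "\<epsilon> n > 0" and \<delta>_pos: "\<delta> n > 0" for n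
    using ux y_incr[of n] y_decr[of n] g_y[of n] by (cases "x < u x"; force simp: \<epsilon>_def \<delta>_def)+
  \<comment> \<open>The square in the relation doubles \<open>\<delta>\<close>, whereas the derivative of \<open>u\<close> acts on \<open>\<delta>\<close> and
      \<open>\<epsilon>\<close> by almost the same factor; \<open>171/100 * (9/11)\<close> exceeds \<open>13/10\<close>.\<close>
  have growth: "\<delta> (Suc n) * \<epsilon> n \<ge> 13/10 * \<delta> n * \<epsilon> (Suc n)" if n: "n \<ge> N" for n
  proof -
    have b: "\<bar>y n - z\<bar> < d" "\<bar>y (Suc n) - z\<bar> < d" "\<bar>g (y n) - z\<bar> < d" "\<bar>gi (y n) - z\<bar> < d"
      "\<bar>gi (gi (y n)) - z\<bar> < d"
      using n N(1)[of n] N(1)[of "Suc n"] N(2)[of n] N(3)[of n] N(4)[of n] by (auto simp: N_def)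
    have memb: "y n \<in> I" "y (Suc n) \<in> I" "g (y n) \<in> I" "gi (y n) \<in> I" "gi (gi (y n)) \<in> I"
      using maps yI by auto
    have e1: "\<bar>gi (y n) - y n\<bar> \<ge> 9/10 * \<delta> n"
      using near_gi[of "y n" "g (y n)"] b memb inv[of "y n"]
      by (simp add: \<delta>_def abs_minus_commute)
    have e2: "\<bar>gi (gi (y n)) - gi (y n)\<bar> \<ge> 9/10 * \<bar>gi (y n) - y n\<bar>"
      using near_gi[of "gi (y n)" "y n"] b memb by simp
    have "\<bar>gi (gi (y n)) - y n\<bar> = \<bar>gi (gi (y n)) - gi (y n)\<bar> + \<bar>gi (y n) - y n\<bar>"
      using less_gi[of "gi (y n)" "y n"] less_gi[of "y n" "gi (y n)"] memb
      by (cases "gi (y n)" "y n" rule: linorder_cases) auto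
    with e1 e2 have e3: "\<bar>gi (gi (y n)) - y n\<bar> \<ge> 171/100 * \<delta> n" by argo
    have "\<delta> (Suc n) = \<bar>u (gi (gi (y n))) - u (y n)\<bar>"
      using rel[of "y n"] memb by (simp add: \<delta>_def ySuc)
    also have "\<dots> \<ge> 9/10 * l * \<bar>gi (gi (y n)) - y n\<bar>"
      using near_u[of "gi (gi (y n))" "y n"] b memb by simp
    finally have "\<delta> (Suc n) \<ge> 9/10 * l * \<bar>gi (gi (y n)) - y n\<bar>" .
    moreover have "9/10 * l * \<bar>gi (gi (y n)) - y n\<bar> \<ge> 9/10 * l * (171/100 * \<delta> n)"
      using e3 \<open>l > 0\<close> by (intro mult_left_mono) auto
    ultimately have e4: "\<delta> (Suc n) \<ge> 1539/1000 * (l * \<delta> n)" by simp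
    have e5: "\<epsilon> (Suc n) \<le> 11/10 * (l * \<epsilon> n)"
      using near_u[of "y (Suc n)" "y n"] b memb by (simp add: \<epsilon>_def ySuc mult_ac)
    have "13/10 * \<delta> n * \<epsilon> (Suc n) \<le> 13/10 * \<delta> n * (11/10 * (l * \<epsilon> n))"
      using e5 \<delta>_pos[of n] by (intro mult_left_mono) auto
    also have "\<dots> = 1430/1000 * (l * \<delta> n) * \<epsilon> n" by simp
    also have "\<dots> \<le> 1539/1000 * (l * \<delta> n) * \<epsilon> n"
      using \<delta>_pos[of n] \<epsilon>_pos[of n] \<open>l > 0\<close> by (intro mult_right_mono) auto
    also have "\<dots> \<le> \<delta> (Suc n) * \<epsilon> n"
      using e4 \<epsilon>_pos[of n] by (intro mult_right_mono) auto
    finally show ?thesis .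
  qed
  define \<rho> where "\<rho> n = \<delta> n / \<epsilon> n" for n
  have \<rho>_step: "\<rho> (Suc n) \<ge> 13/10 * \<rho> n" if "n \<ge> N" for n
    using growth[OF that] \<epsilon>_pos[of n] \<epsilon>_pos[of "Suc n"] by (simp add: \<rho>_def field_simps)
  have \<rho>_pos: "\<rho> n > 0" for n by (simp add: \<rho>_def \<delta>_pos \<epsilon>_pos)
  have \<rho>_growth: "\<rho> (N + k) \<ge> (13/10) ^ k * \<rho> N" for k
  proof (induction k)
    case (Suc k)
    then show ?case using \<rho>_step[of "N + k"] by simp
  qed simp
  \<comment> \<open>If \<open>g\<close> and \<open>u\<close> move \<open>y n\<close> in the same direction, then \<open>g\<close> cannot move it past \<open>u (y n)\<close>,
      a point that \<open>g\<close> moves back.\<close>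
  have bounded: "\<rho> n < 1 \<or> \<rho> (Suc n) < 1" for n
  proof (cases "x < u x")
    case True
    have *: "\<rho> m < 1" if "g (y m) > y m" for m
    proof -
      have "g (y m) < y (Suc m)"
      proof (rule ccontr)
        assume "\<not> g (y m) < y (Suc m)"
        moreover have "g (y m) < g (y (Suc m))" using less_g yI y_incr[OF True] by simp
        moreover have "g (y (Suc m)) < y (Suc m)" using up[OF yI that] by (simp add: ySuc)
        ultimately show False by simp
      qed
      then show ?thesis
        using that y_incr[OF True, of m] by (simp add: \<rho>_def \<delta>_def \<epsilon>_def)
    qed
    show ?thesis using *[of n] *[of "Suc n"] down[OF yI, of n] g_y[of n]
      by (metis linorder_neqE_linordered_idom ySuc)
  next
    case False
    then have lt: "u x < x" using ux by simp
    have *: "\<rho> m < 1" if "g (y m) < y m" for m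
    proof -
      have "g (y m) > y (Suc m)"
      proof (rule ccontr)
        assume "\<not> g (y m) > y (Suc m)"
        moreover have "g (y m) > g (y (Suc m))" using less_g yI y_decr[OF lt] by simp
        moreover have "g (y (Suc m)) > y (Suc m)" using down[OF yI that] by (simp add: ySuc)
        ultimately show False by simp
      qed
      then show ?thesis
        using that y_decr[OF lt, of m] by (simp add: \<rho>_def \<delta>_def \<epsilon>_def)
    qed
    show ?thesis using *[of n] *[of "Suc n"] up[OF yI, of n] g_y[of n]
      by (metis linorder_neqE_linordered_idom ySuc)
  qed
  obtain k where k: "(13/10::real) ^ k > 1 / \<rho> N"
    using real_arch_pow[of "13/10"] by auto
  then have "1 < (13/10) ^ k * \<rho> N" using \<rho>_pos[of N] by (simp add: pos_divide_less_eq)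
  then have "\<rho> (N + k) \<ge> 1" using \<rho>_growth[of k] by linarith
  moreover from this have "\<rho> (Suc (N + k)) \<ge> 1" using \<rho>_step[of "N + k"] by simp
  ultimately show False using bounded[of "N + k"] by simp
qed

text \<open>
  Diffeomorphisms come with an explicit inverse, because the orbits and the derivative estimates
  use it as much as the map itself.
\<close>

definition C1_increasing_pair :: "real set \<Rightarrow> (real \<Rightarrow> real) \<Rightarrow> (real \<Rightarrow> real) \<Rightarrow> bool" where
  "C1_increasing_pair J f fi \<longleftrightarrow>
     (\<forall>x\<in>J. f x \<in> J \<and> fi x \<in> J \<and> f (fi x) = x \<and> fi (f x) = x) \<and>
     strict_mono_on J f \<and> C1_within J f \<and> C1_within J fi"

lemma C1_increasing_pairD:
  assumes "C1_increasing_pair J f fi"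
  shows "x \<in> J \<Longrightarrow> f x \<in> J" "x \<in> J \<Longrightarrow> fi x \<in> J" "x \<in> J \<Longrightarrow> f (fi x) = x"
    "x \<in> J \<Longrightarrow> fi (f x) = x" "x \<in> J \<Longrightarrow> y \<in> J \<Longrightarrow> f x < f y \<longleftrightarrow> x < y"
    "strict_mono_on J f" "C1_within J f" "C1_within J fi"
  using assms unfolding C1_increasing_pair_def by (auto simp: strict_mono_on_less)

lemma C1_increasing_pair_sym:
  assumes "C1_increasing_pair J f fi"
  shows "C1_increasing_pair J fi f"
proof -
  note f = C1_increasing_pairD[OF assms]
  have "strict_mono_on J fi"
  proof (rule strict_mono_onI)
    fix x y assume "x \<in> J" "y \<in> J" "x < y"
    then show "fi x < fi y" using f(5)[of "fi x" "fi y"] f(2,3) by simp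
  qed
  then show ?thesis using f unfolding C1_increasing_pair_def by auto
qed

lemma C1_within_continuous_on: "C1_within J f \<Longrightarrow> continuous_on J f"
  unfolding C1_within_def using DERIV_continuous_on by blast

lemma C1_within_subset:
  assumes "C1_within J f" "I \<subseteq> J"
  shows "C1_within I f"
  using assms unfolding C1_within_def by (meson DERIV_subset continuous_on_subset subsetD)

lemma strict_mono_on_derivative_nonneg:
  fixes f :: "real \<Rightarrow> real"
  assumes mono: "strict_mono_on I f" and der: "(f has_real_derivative D) (at z within I)"
    and "z \<in> I" "at z within I \<noteq> bot"
  shows "0 \<le> D"
proof (rule tendsto_lowerbound[OF _ _ \<open>at z within I \<noteq> bot\<close>])
  show "((\<lambda>y. (f y - f z) / (y - z)) \<longlongrightarrow> D) (at z within I)"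
    using der by (simp add: has_field_derivative_iff)
  have "0 \<le> (f y - f z) / (y - z)" if "y \<in> I" "y \<noteq> z" for y
    using that \<open>z \<in> I\<close> strict_mono_onD[OF mono, of y z] strict_mono_onD[OF mono, of z y]
    by (cases y z rule: linorder_cases) (auto simp: divide_nonpos_neg less_imp_le)
  then show "\<forall>\<^sub>F y in at z within I. 0 \<le> (f y - f z) / (y - z)"
    by (auto simp: eventually_at_filter)
qed

text \<open>
  Without a fixed point beyond \<open>x\<close>, the map \<open>T\<close> would lie entirely above or entirely below the identity
  there; conjugation by \<open>S\<close> preserves this alternative, whereas inversion swaps the two cases.
\<close>

lemma fixed_point_beyond_if_conjugate_to_inverse:
  assumes J: "is_interval J" and T: "C1_increasing_pair J T Ti" and S: "C1_increasing_pair J S Si"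
    and rel: "\<And>x. x \<in> J \<Longrightarrow> T (S (T x)) = S x" and x: "x \<in> J"
  shows "\<exists>q\<in>J. x \<le> q \<and> T q = q"
proof (rule ccontr)
  note T = C1_increasing_pairD[OF T] and S = C1_increasing_pairD[OF S]
  assume none: "\<not> (\<exists>q\<in>J. x \<le> q \<and> T q = q)"
  define K where "K = J \<inter> {x..}"
  have "connected K"
    using J by (auto simp: K_def is_interval_connected_1[symmetric] intro: is_interval_Int is_interval_ci)
  moreover have cont: "continuous_on K (\<lambda>y. T y - y)"
    using C1_within_continuous_on[OF T(7)]
    by (auto simp: K_def intro!: continuous_intros intro: continuous_on_subset)
  ultimately have conn: "connected ((\<lambda>y. T y - y) ` K)" by (rule connected_continuous_image[rotated])
  have no_zero: "0 \<notin> (\<lambda>y. T y - y) ` K" using none by (auto simp: K_def)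
  have same: "T y > y \<longleftrightarrow> T z > z" if "y \<in> K" "z \<in> K" for y z
    using connectedD_interval[OF conn, of "T y - y" "T z - z" 0]
      connectedD_interval[OF conn, of "T z - z" "T y - y" 0] that no_zero by force
  have "\<exists>y\<in>K. \<exists>z\<in>K. T y > y \<and> \<not> T z > z"
  proof -
    \<comment> \<open>The maximum ensures that both \<open>y\<close> and \<open>S y\<close> lie beyond \<open>x\<close>.\<close>
    define y where "y = max x (Si x)"
    have y: "y \<in> J" "x \<le> y" using x S by (auto simp: y_def max_def)
    have "S y \<ge> x"
      using S(5)[of y "Si x"] S(2,3) x y by (auto simp: y_def not_less[symmetric])
    then have K: "y \<in> K" "S y \<in> K" using y S by (auto simp: K_def)
    have yJ: "S y \<in> J" "T y \<in> J" "S (T y) \<in> J" using y S T by auto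
    consider "T y > y" | "T y < y" using none y by (meson linorder_neqE_linordered_idom)
    then show ?thesis
    proof cases
      case 1
      then have "S y < S (T y)" using S(5) yJ y by simp
      then have "T (S y) < S y" using T(5)[of "S y" "S (T y)"] yJ rel y by simp
      then show ?thesis using 1 K by force
    next
      case 2
      then have "S (T y) < S y" using S(5) yJ y by simp
      then have "S y < T (S y)" using T(5)[of "S (T y)" "S y"] yJ rel y by simp
      then show ?thesis using 2 K by force
    qed
  qed
  then show False using same by blast
qed

text \<open>
  A fixed point of \<open>T\<close> on either side of \<open>x\<close> encloses \<open>x\<close> in a compact interval. Its end points are
  fixed by \<open>H\<close> as well: if \<open>H\<close> moved a fixed point of \<open>T\<close> up, then so would \<open>T H T\<^sup>-\<^sup>1\<close>, but
  \<open>H\<^sup>-\<^sup>2\<close> moves it down.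
\<close>

lemma trivial_right_of_fixed_point:
  assumes J: "is_interval J"
    and H: "C1_increasing_pair J H Hi" and T: "C1_increasing_pair J T Ti"
    and S: "C1_increasing_pair J S Si"
    and HT: "\<And>x. x \<in> J \<Longrightarrow> H (H (T (H x))) = T x"
    and ST: "\<And>x. x \<in> J \<Longrightarrow> T (S (T x)) = S x"
    and p: "p \<in> J" "T p = p" and x: "x \<in> J" "p \<le> x"
  shows "H x = x"
proof -
  obtain q where q: "q \<in> J" "x \<le> q" "T q = q"
    using fixed_point_beyond_if_conjugate_to_inverse[OF J T S ST x(1)] by blast
  define I where "I = {p..q}"
  have IJ: "I \<subseteq> J"
    using J p q unfolding I_def is_interval_1 by (meson atLeastAtMost_iff subsetI)
  note Ti = C1_increasing_pair_sym[OF T] and Hi = C1_increasing_pair_sym[OF H]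
  have fixed_H: "H z = z" if "z \<in> J" "T z = z" for z
  proof (cases "H z" z rule: linorder_cases)
    note H = C1_increasing_pairD[OF H] and T = C1_increasing_pairD[OF T]
    case less
    then have "T (H z) < z" using T(5)[of "H z" z] H that by simp
    then have "H (T (H z)) < H z" using H(5) T(1) H(1) that by simp
    then have "H (H (T (H z))) < z" using less H(5)[of "H (T (H z))" z] H(1) T(1) that by simp
    then show ?thesis using HT that by simp
  next
    note H = C1_increasing_pairD[OF H] and T = C1_increasing_pairD[OF T]
    case greater
    then have "T (H z) > z" using T(5)[of z "H z"] H that by simp
    then have "H (T (H z)) > H z" using H(5) T(1) H(1) that by simp
    then have "H (H (T (H z))) > z" using greater H(5)[of z "H (T (H z))"] H(1) T(1) that by simp
    then show ?thesis using HT that by simp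
  qed
  have stable: "f z \<in> I" if "C1_increasing_pair J f fi" "f p = p" "f q = q" "z \<in> I" for f fi z
    using C1_increasing_pairD(5)[OF that(1), of z p] C1_increasing_pairD(5)[OF that(1), of q z]
      that p q IJ by (force simp: I_def)
  have ends: "H p = p" "H q = q" "Hi p = p" "Hi q = q" "Ti p = p" "Ti q = q"
    using fixed_H p q C1_increasing_pairD(4)[OF H] C1_increasing_pairD(4)[OF T] by metis+
  show ?thesis
  proof (cases "p = q")
    case True
    then show ?thesis using ends x q by auto
  next
    case False
    then have "p < q" using x q by simp
    have nontriv: "at z within I \<noteq> bot" if "z \<in> I" for z
      using that \<open>p < q\<close> by (metis I_def atLeastAtMost_iff islimpt_Icc trivial_limit_within)
    obtain T' where T': "\<And>z. z \<in> I \<Longrightarrow> (T has_real_derivative T' z) (at z within I)"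
      using C1_within_subset[OF C1_increasing_pairD(7)[OF T] IJ] by (auto simp: C1_within_def)
    obtain Ti' where Ti': "\<And>z. z \<in> I \<Longrightarrow> (Ti has_real_derivative Ti' z) (at z within I)"
      "continuous_on I Ti'"
      using C1_within_subset[OF C1_increasing_pairD(8)[OF T] IJ] by (auto simp: C1_within_def)
    obtain Hi' where Hi': "\<And>z. z \<in> I \<Longrightarrow> (Hi has_real_derivative Hi' z) (at z within I)"
      "continuous_on I Hi'"
      using C1_within_subset[OF C1_increasing_pairD(8)[OF H] IJ] by (auto simp: C1_within_def)
    have TiI: "Ti z \<in> I" if "z \<in> I" for z using stable[OF Ti] ends that by simp
    have mono: "strict_mono_on I H" "strict_mono_on I Ti"
      using C1_increasing_pairD(6)[OF H] C1_increasing_pairD(6)[OF Ti] IJ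
      by (auto intro: monotone_on_subset)
    have "0 < Ti' z" if z: "z \<in> I" for z
    proof -
      have "(T has_real_derivative T' (Ti z)) (at (Ti z) within Ti ` I)"
        using T'[OF TiI[OF z]] TiI by (auto intro: DERIV_subset)
      from DERIV_image_chain[OF this Ti'(1)[OF z]]
      have "((\<lambda>x. x) has_real_derivative T' (Ti z) * Ti' z) (at z within I)"
        by (rule has_field_derivative_transform_within[OF _ zero_less_one z])
           (use IJ C1_increasing_pairD(3)[OF T] in auto)
      then have "T' (Ti z) * Ti' z = 1"
        using has_field_derivative_unique[OF _ DERIV_ident nontriv[OF z]] by blast
      moreover have "0 \<le> Ti' z"
        by (rule strict_mono_on_derivative_nonneg[OF mono(2) Ti'(1)[OF z] z nontriv[OF z]])
      ultimately show ?thesis by (cases "Ti' z = 0") auto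
    qed
    note Ti'_pos = this
    show ?thesis
    proof (rule inverse_square_relation_imp_trivial[where gi = Hi and u = Ti and gi' = Hi' and u' = Ti'
            and p = p and q = q])
      fix z assume z: "z \<in> {p..q}"
      then have "z \<in> I" "z \<in> J" using IJ by (auto simp: I_def)
      show "H z \<in> {p..q} \<and> Hi z \<in> {p..q} \<and> Ti z \<in> {p..q}"
        using stable[OF H] stable[OF Hi] TiI ends \<open>z \<in> I\<close> by (simp add: I_def)
      show "H (Hi z) = z \<and> Hi (H z) = z" using C1_increasing_pairD(3,4)[OF H] \<open>z \<in> J\<close> by simp
      show "H (Ti z) = Ti (Hi (Hi z))"
        using HT[of "Ti z"] C1_increasing_pairD(1-4)[OF H] C1_increasing_pairD(1-4)[OF T] \<open>z \<in> J\<close>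
        by metis
    qed (use Ti' Hi' Ti'_pos mono C1_within_continuous_on[OF C1_increasing_pairD(7)[OF H]] IJ x q
      in \<open>auto simp: I_def intro: continuous_on_subset\<close>)
  qed
qed

section \<open>The obstruction\<close>

text \<open>
  The relations \<open>x v\<^sup>2 x = v\<^sup>2\<close>, \<open>b\<^sup>2 x\<^sup>4 b = x\<^sup>4\<close> and \<open>g = f b\<^sup>6 f\<^sup>-\<^sup>1 b\<^sup>-\<^sup>6\<close>, written without
  inverses so that they are conditions on finitely many entries of the multiplication table.
\<close>

definition smooth_obstruction :: "('a, 'b) monoid_scheme \<Rightarrow> 'a \<Rightarrow> 'a \<Rightarrow> 'a \<Rightarrow> 'a \<Rightarrow> 'a \<Rightarrow> bool" where
  "smooth_obstruction G g v x b f \<longleftrightarrow>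
     x \<otimes>\<^bsub>G\<^esub> v [^]\<^bsub>G\<^esub> (2::nat) \<otimes>\<^bsub>G\<^esub> x = v [^]\<^bsub>G\<^esub> (2::nat) \<and>
     b [^]\<^bsub>G\<^esub> (2::nat) \<otimes>\<^bsub>G\<^esub> x [^]\<^bsub>G\<^esub> (4::nat) \<otimes>\<^bsub>G\<^esub> b = x [^]\<^bsub>G\<^esub> (4::nat) \<and>
     g \<otimes>\<^bsub>G\<^esub> b [^]\<^bsub>G\<^esub> (6::nat) \<otimes>\<^bsub>G\<^esub> f = f \<otimes>\<^bsub>G\<^esub> b [^]\<^bsub>G\<^esub> (6::nat)"

context group
begin

lemma sandwich_pow:
  assumes "a \<in> carrier G" "s \<in> carrier G" "a \<otimes> s \<otimes> a = s"
  shows "a [^] (k::nat) \<otimes> s \<otimes> a [^] k = s"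
proof (induction k)
  case (Suc k)
  have "a [^] Suc k \<otimes> s \<otimes> a [^] Suc k = (a [^] k \<otimes> a) \<otimes> s \<otimes> (a \<otimes> a [^] k)"
    using assms(1) by (metis nat_pow_Suc nat_pow_Suc2)
  also have "\<dots> = a [^] k \<otimes> (a \<otimes> s \<otimes> a) \<otimes> a [^] k" using assms(1,2) by (simp add: m_assoc)
  finally have "a [^] Suc k \<otimes> s \<otimes> a [^] Suc k = a [^] k \<otimes> (a \<otimes> s \<otimes> a) \<otimes> a [^] k" .
  then show ?case using Suc assms by simp
qed (use assms in simp)

lemma double_sandwich_pow:
  assumes "a \<in> carrier G" "s \<in> carrier G" "a [^] (2::nat) \<otimes> s \<otimes> a = s"
  shows "a [^] (2 * k::nat) \<otimes> s \<otimes> a [^] k = s"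
proof (induction k)
  case (Suc k)
  have "a [^] (2 * Suc k) = a [^] (2 * k) \<otimes> a [^] (2::nat)"
    using assms by (simp add: nat_pow_mult)
  then have "a [^] (2 * Suc k) \<otimes> s \<otimes> a [^] Suc k =
      (a [^] (2 * k) \<otimes> a [^] (2::nat)) \<otimes> s \<otimes> (a \<otimes> a [^] k)"
    using assms(1) by (metis nat_pow_Suc2)
  also have "\<dots> = a [^] (2 * k) \<otimes> (a [^] (2::nat) \<otimes> s \<otimes> a) \<otimes> a [^] k"
    using assms(1,2) by (simp add: m_assoc)
  finally have "a [^] (2 * Suc k) \<otimes> s \<otimes> a [^] Suc k =
      a [^] (2 * k) \<otimes> (a [^] (2::nat) \<otimes> s \<otimes> a) \<otimes> a [^] k" .
  then show ?case using Suc assms by simp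
qed (use assms in simp)

text \<open>
  The relations in the form used by the dynamics: \<open>v\<^sup>2\<close> conjugates \<open>x\<^sup>2\<close> and \<open>x\<^sup>4\<close> to their inverses,
  \<open>x\<^sup>4\<close> conjugates \<open>b\<^sup>2\<close> and \<open>b\<^sup>6\<close> to their inverse squares. All the elements that act are squares, so
  they act by increasing maps.
\<close>

lemma smooth_obstruction_relations:
  assumes "smooth_obstruction G g v x b f" and carr: "v \<in> carrier G" "x \<in> carrier G" "b \<in> carrier G"
  defines "s \<equiv> v \<otimes> v" and "w \<equiv> x \<otimes> x" and "c \<equiv> b \<otimes> b"
  shows "w \<otimes> s \<otimes> w = s" "c \<otimes> c \<otimes> (w \<otimes> w) \<otimes> c = w \<otimes> w" "c \<otimes> c \<otimes> c = b [^] (6::nat)"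
    "(w \<otimes> w) \<otimes> s \<otimes> (w \<otimes> w) = s" 
    "b [^] (6::nat) \<otimes> b [^] (6::nat) \<otimes> (w \<otimes> w) \<otimes> b [^] (6::nat) = w \<otimes> w"
    "b [^] (6::nat) = (b [^] (3::nat)) \<otimes> (b [^] (3::nat))"
proof -
  have sq: "a [^] (2::nat) = a \<otimes> a" if "a \<in> carrier G" for a
    using that by (simp add: numeral_2_eq_2)
  have w: "x [^] (4::nat) = w \<otimes> w" and ww: "x [^] (2::nat) = w"
    using nat_pow_mult[of x 2 2] carr sq[of x] by (simp_all add: w_def)
  have s: "v [^] (2::nat) = s" and c: "b [^] (2::nat) = c" using sq carr by (simp_all add: s_def c_def)
  have x: "x \<otimes> s \<otimes> x = s" and b: "b [^] (2::nat) \<otimes> (w \<otimes> w) \<otimes> b = w \<otimes> w"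
    using assms(1) by (simp_all add: smooth_obstruction_def w s)
  have memb: "s \<in> carrier G" "w \<in> carrier G" "c \<in> carrier G"
    using carr by (simp_all add: s_def w_def c_def)
  show "w \<otimes> s \<otimes> w = s" using sandwich_pow[OF _ _ x, of 2] carr memb by (simp add: ww)
  show "(w \<otimes> w) \<otimes> s \<otimes> (w \<otimes> w) = s" using sandwich_pow[OF _ _ x, of 4] carr memb by (simp add: w)
  have "b [^] (4::nat) = c \<otimes> c" using nat_pow_mult[of b 2 2] carr by (simp add: c)
  then show "c \<otimes> c \<otimes> (w \<otimes> w) \<otimes> c = w \<otimes> w"
    using double_sandwich_pow[OF _ _ b, of 2] carr memb by (simp add: c)
  show "c \<otimes> c \<otimes> c = b [^] (6::nat)"
    using \<open>b [^] (4::nat) = c \<otimes> c\<close> nat_pow_mult[of b 4 2] carr by (simp add: c)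
  show "b [^] (6::nat) \<otimes> b [^] (6::nat) \<otimes> (w \<otimes> w) \<otimes> b [^] (6::nat) = w \<otimes> w"
    using double_sandwich_pow[OF _ _ b, of 6] carr memb by (simp add: nat_pow_mult)
  show "b [^] (6::nat) = (b [^] (3::nat)) \<otimes> (b [^] (3::nat))"
    using carr by (simp add: nat_pow_mult)
qed

text \<open>
  If \<open>b > 1\<close> in a bi-invariant order, then \<open>t < b t < b\<^sup>2 t < b\<^sup>2 t b = t\<close> with \<open>t = x\<^sup>4\<close>; if \<open>b < 1\<close>, the
  inequalities are reversed.
\<close>

lemma biorderable_obstruction:
  assumes ob: "smooth_obstruction G g v x b f"
    and carr: "v \<in> carrier G" "x \<in> carrier G" "b \<in> carrier G" "f \<in> carrier G" "g \<in> carrier G"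
    and "g \<noteq> \<one>"
  shows "\<not> biorderable G"
proof
  assume "biorderable G"
  then obtain r where lin: "linear_order_on (carrier G) r"
    and left: "\<And>a b c. \<lbrakk>a \<in> carrier G; b \<in> carrier G; c \<in> carrier G; (a, b) \<in> r\<rbrakk> \<Longrightarrow> (c \<otimes> a, c \<otimes> b) \<in> r"
    and right: "\<And>a b c. \<lbrakk>a \<in> carrier G; b \<in> carrier G; c \<in> carrier G; (a, b) \<in> r\<rbrakk> \<Longrightarrow> (a \<otimes> c, b \<otimes> c) \<in> r"
    unfolding biorderable_def by blast
  have antisym: "antisym r" and trans: "trans r"
    using lin by (auto simp: order_on_defs)
  define t where "t = x [^] (4::nat)"
  have t: "t \<in> carrier G" using carr by (simp add: t_def)
  have rel: "b \<otimes> b \<otimes> t \<otimes> b = t"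
    using ob carr by (simp add: smooth_obstruction_def t_def numeral_2_eq_2)
  have "b \<noteq> \<one>"
    using ob carr \<open>g \<noteq> \<one>\<close> by (auto simp: smooth_obstruction_def)
  then consider "(\<one>, b) \<in> r" | "(b, \<one>) \<in> r"
    using lin carr by (auto simp: order_on_defs total_on_def)
  then have "b \<otimes> t = t"
  proof cases
    case 1
    have "(t, b \<otimes> t) \<in> r" using right[OF _ _ _ 1, of t] carr t by simp
    moreover have "(b \<otimes> t, b \<otimes> (b \<otimes> t)) \<in> r" using left[OF _ _ _ calculation, of b] carr t by simp
    moreover have "(b \<otimes> (b \<otimes> t), t) \<in> r"
      using left[OF _ _ _ 1, of "b \<otimes> b \<otimes> t"] carr t rel by (simp add: m_assoc)
    ultimately show ?thesis using antisym trans by (meson antisymD transD)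
  next
    case 2
    have "(b \<otimes> t, t) \<in> r" using right[OF _ _ _ 2, of t] carr t by simp
    moreover have "(b \<otimes> (b \<otimes> t), b \<otimes> t) \<in> r" using left[OF _ _ _ calculation, of b] carr t by simp
    moreover have "(t, b \<otimes> (b \<otimes> t)) \<in> r"
      using left[OF _ _ _ 2, of "b \<otimes> b \<otimes> t"] carr t rel by (simp add: m_assoc)
    ultimately show ?thesis using antisym trans by (meson antisymD transD)
  qed
  then show False using \<open>b \<noteq> \<one>\<close> carr t by simp
qed

end

lemma obstruction_trivial_if_power_trivial:
  assumes "group_action G M \<phi>" and ob: "smooth_obstruction G g v x b f"
    and carr: "v \<in> carrier G" "x \<in> carrier G" "b \<in> carrier G" "f \<in> carrier G" "g \<in> carrier G"
    and triv: "\<And>y. y \<in> M \<Longrightarrow> \<phi> (b [^]\<^bsub>G\<^esub> (6::nat)) y = y" and y: "y \<in> M"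
  shows "\<phi> g y = y"
proof -
  interpret act: group_action G M \<phi> by fact
  interpret group G using act.group_hom by (rule group_hom.axioms)
  define h where "h = b [^]\<^bsub>G\<^esub> (6::nat)"
  have h: "h \<in> carrier G" using carr by (simp add: h_def)
  have img: "\<phi> k z \<in> M" if "k \<in> carrier G" "z \<in> M" for k z
    using that act.element_image by blast
  obtain z where z: "z \<in> M" "\<phi> f z = y" using act.bij_prop1[OF carr(4) y] by blast
  have "\<phi> (g \<otimes>\<^bsub>G\<^esub> h \<otimes>\<^bsub>G\<^esub> f) z = \<phi> (f \<otimes>\<^bsub>G\<^esub> h) z"
    using ob by (simp add: smooth_obstruction_def h_def)
  then show ?thesis
    using z h carr y triv img by (simp add: act.composition_rule h_def[symmetric])
qed

section \<open>Actions on intervals\<close>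

lemma interval_action_C1_increasing_pair:
  assumes "group_action G J \<phi>" and J: "is_interval J"
    and C1: "\<And>g. g \<in> carrier G \<Longrightarrow> C1_diffeo_interval J (\<phi> g)" and k: "k \<in> carrier G"
  shows "C1_increasing_pair J (\<phi> (k \<otimes>\<^bsub>G\<^esub> k)) (\<phi> (inv\<^bsub>G\<^esub> (k \<otimes>\<^bsub>G\<^esub> k)))"
proof -
  interpret act: group_action G J \<phi> by fact
  interpret group G using act.group_hom by (rule group_hom.axioms)
  have img: "\<phi> k z \<in> J" if "k \<in> carrier G" "z \<in> J" for k z
    using that act.element_image by blast
  have one: "\<phi> \<one>\<^bsub>G\<^esub> z = z" if "z \<in> J" for z using that act.id_eq_one by (metis restrict_apply')
  have C1: "C1_within J (\<phi> g)" if "g \<in> carrier G" for g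
    using C1[OF that] by (simp add: C1_diffeo_interval_def)
  have "strict_mono_on J (\<phi> k) \<or> strict_antimono_on J (\<phi> k)"
    using injective_eq_monotone_map[OF J C1_within_continuous_on[OF C1[OF k]]] act.inj_prop[OF k]
    by simp
  then have "strict_mono_on J (\<lambda>z. \<phi> k (\<phi> k z))"
    using img[OF k] by (auto simp: monotone_on_def)
  then have mono: "strict_mono_on J (\<phi> (k \<otimes>\<^bsub>G\<^esub> k))"
    using k by (simp add: act.composition_rule strict_mono_on_def)
  let ?m = "k \<otimes>\<^bsub>G\<^esub> k"
  have m: "?m \<in> carrier G" using k by simp
  have "\<phi> ?m (\<phi> (inv\<^bsub>G\<^esub> ?m) z) = z \<and> \<phi> (inv\<^bsub>G\<^esub> ?m) (\<phi> ?m z) = z" if "z \<in> J" for z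
    using act.composition_rule[OF that m inv_closed[OF m]]
      act.composition_rule[OF that inv_closed[OF m] m] m that one by simp
  then show ?thesis
    using mono C1 m inv_closed[OF m] img unfolding C1_increasing_pair_def by blast
qed

text \<open>
  The least element of \<open>J\<close> is fixed by every increasing bijection and serves as the left fixed
  point; the interval may be open on the right.
\<close>

lemma obstruction_trivial_on_interval:
  assumes "group_action G J \<phi>" and J: "is_interval J"
    and C1: "\<And>g. g \<in> carrier G \<Longrightarrow> C1_diffeo_interval J (\<phi> g)"
    and least: "a \<in> J" "\<And>y. y \<in> J \<Longrightarrow> a \<le> y"
    and ob: "smooth_obstruction G g v x b f"
    and carr: "v \<in> carrier G" "x \<in> carrier G" "b \<in> carrier G" "f \<in> carrier G" "g \<in> carrier G"
    and y: "y \<in> J"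
  shows "\<phi> g y = y"
proof (rule obstruction_trivial_if_power_trivial[OF assms(1) ob carr _ y])
  fix y assume y: "y \<in> J"
  interpret act: group_action G J \<phi> by fact
  interpret group G using act.group_hom by (rule group_hom.axioms)
  have img: "\<phi> k z \<in> J" if "k \<in> carrier G" "z \<in> J" for k z
    using that act.element_image by blast
  define w where "w = x \<otimes>\<^bsub>G\<^esub> x"
  define h where "h = b [^]\<^bsub>G\<^esub> (6::nat)"
  note rels = smooth_obstruction_relations[OF ob carr(1-3)]
  have pair: "C1_increasing_pair J (\<phi> (k \<otimes>\<^bsub>G\<^esub> k)) (\<phi> (inv\<^bsub>G\<^esub> (k \<otimes>\<^bsub>G\<^esub> k)))"
    if "k \<in> carrier G" for k
    using interval_action_C1_increasing_pair[OF assms(1) J] C1 that by blast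
  have carr': "w \<in> carrier G" "b [^]\<^bsub>G\<^esub> (3::nat) \<in> carrier G" "h \<in> carrier G" "v \<otimes>\<^bsub>G\<^esub> v \<in> carrier G"
    using carr by (simp_all add: w_def h_def)
  have H: "C1_increasing_pair J (\<phi> h) (\<phi> (inv\<^bsub>G\<^esub> h))"
    using pair[OF carr'(2)] rels(6) by (simp add: h_def)
  note T = pair[OF carr'(1)] and S = pair[OF carr(1)]
  have T_a: "\<phi> (w \<otimes>\<^bsub>G\<^esub> w) a = a"
  proof (rule antisym)
    note T = C1_increasing_pairD[OF T]
    show "a \<le> \<phi> (w \<otimes>\<^bsub>G\<^esub> w) a" using T(1) least by blast
    show "\<phi> (w \<otimes>\<^bsub>G\<^esub> w) a \<le> a"
      using T(2,3)[of a] T(5)[of "\<phi> (inv\<^bsub>G\<^esub> (w \<otimes>\<^bsub>G\<^esub> w)) a" a] least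
      by (metis linorder_not_less)
  qed
  have "\<phi> h y = y"
  proof (rule trivial_right_of_fixed_point[OF J H T S _ _ least(1) T_a y least(2)[OF y]])
    fix z assume z: "z \<in> J"
    show "\<phi> h (\<phi> h (\<phi> (w \<otimes>\<^bsub>G\<^esub> w) (\<phi> h z))) = \<phi> (w \<otimes>\<^bsub>G\<^esub> w) z"
      using arg_cong[OF rels(5)[folded w_def h_def], of "\<lambda>k. \<phi> k z"] carr' z img
      by (simp add: act.composition_rule)
    show "\<phi> (w \<otimes>\<^bsub>G\<^esub> w) (\<phi> (v \<otimes>\<^bsub>G\<^esub> v) (\<phi> (w \<otimes>\<^bsub>G\<^esub> w) z)) = \<phi> (v \<otimes>\<^bsub>G\<^esub> v) z"
      using arg_cong[OF rels(4)[folded w_def], of "\<lambda>k. \<phi> k z"] carr' carr z img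
      by (simp add: act.composition_rule)
  qed
  then show "\<phi> (b [^]\<^bsub>G\<^esub> (6::nat)) y = y" by (simp add: h_def)
qed

section \<open>Actions on the circle\<close>

definition circle_lift :: "(real \<Rightarrow> real) \<Rightarrow> (complex \<Rightarrow> complex) \<Rightarrow> bool" where
  "circle_lift F f \<longleftrightarrow> continuous_on UNIV F \<and> (\<forall>x. cis (F x) = f (cis x))"

lemma cis_eq_iff: "cis a = cis b \<longleftrightarrow> (\<exists>n::int. a = b + 2 * pi * n)"
  using sin_cos_eq_iff[of a b] by (auto simp: complex_eq_iff)

lemma cis_mem_unit_circle: "cis a \<in> unit_circle"
  by simp

lemma circle_lift_exists:
  assumes C1: "(f \<circ> cis) C1_differentiable_on UNIV" and f: "f ` unit_circle \<subseteq> unit_circle"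
  shows "\<exists>F. circle_lift F f"
proof -
  have norm_f: "norm (f (cis x)) = 1" for x
    using f cis_mem_unit_circle[of x] by (metis dist_0_norm image_subset_iff mem_sphere)
  have "continuous_on UNIV (f \<circ> cis)"
    using C1_diff_imp_diff[OF C1] differentiable_imp_continuous_on by blast
  moreover have "contractible (UNIV :: real set)" by simp
  moreover have "(f \<circ> cis) x \<noteq> 0" for x using norm_f[of x] by auto
  ultimately obtain g where g: "continuous_on UNIV g" "\<And>x. (f \<circ> cis) x = exp (g x)"
    using continuous_logarithm_on_contractible by (metis UNIV_I)
  have "exp (Re (g x)) = 1" for x
    using norm_f[of x] g(2)[of x] by simp
  then have "cis (Im (g x)) = f (cis x)" for x
    using g(2)[of x] exp_eq_polar[of "g x"] by (metis mult_1 of_real_1 o_apply of_real_exp)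
  moreover have "continuous_on UNIV (\<lambda>x. Im (g x))" by (intro continuous_intros g)
  ultimately show ?thesis unfolding circle_lift_def by blast
qed

text \<open>
  Locally \<open>F\<close> differs by a constant from a branch of the argument of \<open>f \<circ> cis\<close>, so it inherits the regularity of
  \<open>f \<circ> cis\<close>.
\<close>

lemma circle_lift_C1:
  assumes C1: "(f \<circ> cis) C1_differentiable_on UNIV" and lift: "circle_lift F f"
  shows "C1_within UNIV F"
proof -
  have F: "continuous_on UNIV F" "\<And>x. f (cis x) = cis (F x)"
    using lift by (auto simp: circle_lift_def)
  define h where "h = f \<circ> cis"
  have h: "h x = cis (F x)" for x by (simp add: h_def F)
  obtain D where D: "\<And>x. (h has_vector_derivative D x) (at x)" "continuous_on UNIV D"
    using C1 by (auto simp: C1_differentiable_on_def h_def)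
  have h_cont: "continuous_on UNIV h"
    unfolding h_def using C1_diff_imp_diff[OF C1] differentiable_imp_continuous_on by blast
  have "(F has_real_derivative Im (D x / h x)) (at x)" for x
  proof -
    have "((\<lambda>y. h y / h x) has_vector_derivative D x / h x) (at x)"
      using has_vector_derivative_divide[OF D(1)[of x], of "h x"] by simp
    moreover have "(Ln has_field_derivative inverse 1) (at (h x / h x))"
      using has_field_derivative_Ln[of 1] by (simp add: h)
    ultimately have "(Ln \<circ> (\<lambda>y. h y / h x) has_vector_derivative (D x / h x) * inverse 1) (at x)"
      by (rule field_vector_diff_chain_at)
    from bounded_linear.has_vector_derivative[OF bounded_linear_Im this]
    have "((\<lambda>y. Im (Ln (h y / h x))) has_real_derivative Im (D x / h x)) (at x)"
      by (simp add: o_def has_real_derivative_iff_has_vector_derivative)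
    then have *: "((\<lambda>y. F x + Im (Ln (h y / h x))) has_real_derivative Im (D x / h x)) (at x)"
      using DERIV_add[OF DERIV_const[of "F x"]] by simp
    have "isCont F x" using F(1) by (simp add: continuous_on_eq_continuous_at)
    then obtain d where d: "d > 0" "\<And>y. dist y x < d \<Longrightarrow> dist (F y) (F x) < pi"
      using pi_gt_zero by (metis continuous_at_eps_delta)
    show ?thesis
    proof (rule has_field_derivative_transform_within[OF * d(1)])
      fix y assume "dist y x < d"
      then have "\<bar>F y - F x\<bar> < pi" using d(2)[of y] by (simp add: dist_real_def)
      moreover have "h y / h x = exp (\<i> * complex_of_real (F y - F x))"
        unfolding h cis_divide by (rule cis_conv_exp)
      ultimately show "F x + Im (Ln (h y / h x)) = F y" by (simp add: abs_less_iff)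
    qed simp
  qed
  moreover have "continuous_on UNIV (\<lambda>x. Im (D x / h x))"
    by (intro continuous_intros D h_cont) (simp add: h)
  ultimately show ?thesis
    unfolding C1_within_def by (intro exI[of _ "\<lambda>x. Im (D x / h x)"]) simp
qed

lemma circle_lifts_differ_by_period:
  assumes F: "circle_lift F f" and G: "circle_lift G f"
  shows "\<exists>n::int. \<forall>x. F x = G x + 2 * pi * n"
proof -
  define d where "d x = (F x - G x) / (2 * pi)" for x
  have cont: "continuous_on UNIV d"
    using F G unfolding d_def circle_lift_def by (intro continuous_intros) auto
  have int: "\<exists>n::int. d x = n" for x
  proof -
    have "cis (F x) = cis (G x)" using F G by (simp add: circle_lift_def)
    then show ?thesis by (auto simp: cis_eq_iff d_def)
  qed
  have "\<exists>e>0. \<forall>y. y \<in> UNIV \<and> d y \<noteq> d x \<longrightarrow> e \<le> norm (d y - d x)" for x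
  proof (intro exI[of _ 1] conjI allI impI)
    fix y assume "y \<in> UNIV \<and> d y \<noteq> d x"
    then show "1 \<le> norm (d y - d x)"
      using int[of x] int[of y] by (auto simp flip: of_int_diff of_int_abs)
  qed simp
  then have "d constant_on UNIV" using continuous_discrete_range_constant[OF connected_UNIV cont] by blast
  then obtain c where c: "\<And>x. d x = c" by (auto simp: constant_on_def)
  obtain n :: int where "c = n" using int[of 0] c by auto
  then have "F x = G x + 2 * pi * n" for x using c[of x] by (simp add: d_def field_simps)
  then show ?thesis by blast
qed

lemma circle_lift_compose:
  assumes "circle_lift F f" "circle_lift G g"
  shows "circle_lift (\<lambda>x. F (G x)) (\<lambda>z. f (g z))"
  using assms continuous_on_compose2[of UNIV F UNIV G] by (simp add: circle_lift_def)

lemma circle_lift_cong: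
  assumes "circle_lift F f" "\<And>z. z \<in> unit_circle \<Longrightarrow> f z = g z"
  shows "circle_lift F g"
  using assms cis_mem_unit_circle by (auto simp: circle_lift_def)

lemma circle_lift_shift:
  assumes "circle_lift F f"
  shows "circle_lift (\<lambda>x. F x + 2 * pi * of_int n) f"
proof -
  have "cis (F x + 2 * pi * of_int n) = cis (F x)" for x by (subst cis_eq_iff) blast
  then show ?thesis using assms by (auto simp: circle_lift_def intro!: continuous_intros)
qed

text \<open>
  Any lift of the inverse inverts \<open>F\<close> up to a period, and this period can be absorbed into the lift.
\<close>

lemma circle_lift_inverse:
  assumes F: "circle_lift F f" and Fi0: "circle_lift Fi0 fi"
    and inv: "\<And>z. z \<in> unit_circle \<Longrightarrow> f (fi z) = z" "\<And>z. z \<in> unit_circle \<Longrightarrow> fi (f z) = z"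
  shows "\<exists>Fi. circle_lift Fi fi \<and> (\<forall>x. F (Fi x) = x \<and> Fi (F x) = x)"
proof -
  have id: "circle_lift (\<lambda>x. x) (\<lambda>z. z)" by (simp add: circle_lift_def)
  have F_lift: "cis (F x) = f (cis x)" and Fi_lift: "cis (Fi0 x) = fi (cis x)" for x
    using F Fi0 by (simp_all add: circle_lift_def)
  obtain n :: int where n: "\<And>x. F (Fi0 x) = x + 2 * pi * n"
    using circle_lifts_differ_by_period[OF circle_lift_cong[OF circle_lift_compose[OF F Fi0] inv(1)] id]
    by auto
  define Fi where "Fi x = Fi0 (x - 2 * pi * n)" for x
  have right: "F (Fi x) = x" for x by (simp add: Fi_def n)
  have "cis (x - 2 * pi * n) = cis x" for x
    using cis_eq_iff[of "x - 2 * pi * n" x] by (auto intro: exI[of _ "-n"])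
  then have lift: "circle_lift Fi fi"
    using Fi0 unfolding circle_lift_def Fi_def
    by (auto intro!: continuous_on_compose2[of UNIV Fi0] continuous_intros)
  obtain m :: int where m: "\<And>x. Fi (F x) = x + 2 * pi * m"
    using circle_lifts_differ_by_period[OF circle_lift_cong[OF circle_lift_compose[OF lift F] inv(2)] id]
    by auto
  \<comment> \<open>The points \<open>x\<close> and \<open>x + 2 * pi * m\<close> have the same image under \<open>F\<close>, hence under \<open>Fi \<circ> F\<close>.\<close>
  have "Fi (F x) = x" for x
    using m[of x] m[of "x + 2 * pi * m"] right[of "F x"] by simp
  then show ?thesis using lift right by blast
qed

text \<open>
  An increasing lift of a circle homeomorphism has degree one: the degrees of \<open>F\<close> and of its inverse
  are both at least one, and their composition has degree one.
\<close>

lemma increasing_lift_commutes_with_periods: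
  assumes F: "circle_lift F f" "strict_mono F" and Fi: "circle_lift Fi fi" "strict_mono Fi"
    and inv: "\<And>x. F (Fi x) = x" "\<And>x. Fi (F x) = x"
  shows "F (x + 2 * pi * of_int n) = F x + 2 * pi * of_int n"
proof -
  have shifted: "\<exists>d::int. (1::int) \<le> d \<and> (\<forall>x. G (x + 2 * pi) = G x + 2 * pi * d)"
    if G: "circle_lift G g" "strict_mono G" for G g
  proof -
    have "cis (x + 2 * pi) = cis x" for x using cis_eq_iff[of "x + 2 * pi" x] by (auto intro: exI[of _ 1])
    then have "circle_lift (\<lambda>x. G (x + 2 * pi)) g"
      using G(1) unfolding circle_lift_def
      by (auto intro!: continuous_on_compose2[of UNIV G] continuous_intros)
    then obtain d :: int where d: "\<And>x. G (x + 2 * pi) = G x + 2 * pi * d"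
      using circle_lifts_differ_by_period[OF _ G(1)] by blast
    have "G 0 < G (0 + 2 * pi)" using G(2) by (simp add: strict_mono_less)
    then have "d \<ge> 1" using d[of 0] by (simp add: zero_less_mult_iff)
    then show ?thesis using d by blast
  qed
  obtain d :: int where d: "d \<ge> 1" "\<And>x. F (x + 2 * pi) = F x + 2 * pi * d"
    using shifted[OF F] by blast
  obtain e :: int where e: "e \<ge> 1" "\<And>x. Fi (x + 2 * pi) = Fi x + 2 * pi * e"
    using shifted[OF Fi] by blast
  have "d = 1"
  proof -
    have "x + 2 * pi \<le> x + 2 * pi * e" for x using e(1) by simp
    then have "F (0 + 2 * pi) \<le> F (0 + 2 * pi * e)"
      using F(2) by (simp add: strict_mono_less_eq)
    also have "0 + 2 * pi * e = Fi (F 0 + 2 * pi)" using e(2)[of "F 0"] inv by simp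
    finally have "F 0 + 2 * pi * d \<le> F 0 + 2 * pi" using d(2)[of 0] inv by simp
    then show ?thesis using d(1) by simp
  qed
  then have step: "F (x + 2 * pi) = F x + 2 * pi" for x using d(2) by simp
  have nat: "F (x + 2 * pi * real k) = F x + 2 * pi * real k" for x and k :: nat
  proof (induction k)
    case (Suc k)
    then show ?case using step[of "x + 2 * pi * real k"] by (simp add: algebra_simps)
  qed simp
  show ?thesis
  proof (cases n)
    case (nonneg k)
    then show ?thesis using nat[of x k] by simp
  next
    case (neg k)
    then have "real_of_int n = - real (Suc k)" by simp
    then have eq: "2 * pi * real_of_int n = - (2 * pi * real (Suc k))"
      by (simp only: mult_minus_right)
    show ?thesis unfolding eq using nat[of "x - 2 * pi * real (Suc k)" "Suc k"] by simp
  qed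
qed

context
  fixes G :: "('a, 'b) monoid_scheme" and \<phi>
  assumes action: "group_action G unit_circle \<phi>"
    and C1: "\<And>g. g \<in> carrier G \<Longrightarrow> C1_diffeo_circle (\<phi> g)"
begin

interpretation act: group_action G unit_circle \<phi> by (fact action)

interpretation group G using act.group_hom by (rule group_hom.axioms)

lemma circle_action_inverse:
  assumes "m \<in> carrier G" "z \<in> unit_circle"
  shows "\<phi> m (\<phi> (inv\<^bsub>G\<^esub> m) z) = z"
  using act.composition_rule[OF assms(2,1) inv_closed[OF assms(1)]] assms act.id_eq_one
  by (metis r_inv restrict_apply')

lemma circle_action_lift_inverse:
  assumes m: "m \<in> carrier G" and F: "circle_lift F (\<phi> m)"
  shows "\<exists>Fi. circle_lift Fi (\<phi> (inv\<^bsub>G\<^esub> m)) \<and> (\<forall>x. F (Fi x) = x \<and> Fi (F x) = x) \<and>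
    C1_within UNIV F \<and> C1_within UNIV Fi"
proof -
  have C1': "(\<phi> k \<circ> cis) C1_differentiable_on UNIV" if "k \<in> carrier G" for k
    using C1[OF that] by (simp add: C1_diffeo_circle_def)
  obtain Fi0 where "circle_lift Fi0 (\<phi> (inv\<^bsub>G\<^esub> m))"
    using circle_lift_exists[OF C1'] act.surj_prop m by blast
  from circle_lift_inverse[OF F this]
  obtain Fi where Fi: "circle_lift Fi (\<phi> (inv\<^bsub>G\<^esub> m))" "\<forall>x. F (Fi x) = x \<and> Fi (F x) = x"
    using circle_action_inverse[OF m] circle_action_inverse[OF inv_closed[OF m]] m by auto
  then show ?thesis
    using circle_lift_C1[OF C1'] m F by blast
qed

lemma circle_action_square_has_increasing_lift:
  assumes k: "k \<in> carrier G"
  shows "\<exists>F. circle_lift F (\<phi> (k \<otimes>\<^bsub>G\<^esub> k)) \<and> strict_mono F"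
proof -
  have "(\<phi> k \<circ> cis) C1_differentiable_on UNIV"
    using C1[OF k] by (simp add: C1_diffeo_circle_def)
  then obtain K where K: "circle_lift K (\<phi> k)"
    using circle_lift_exists act.surj_prop[OF k] by blast
  obtain Ki where "\<forall>x. K (Ki x) = x \<and> Ki (K x) = x" using circle_action_lift_inverse[OF k K] by blast
  then have "inj K" by (metis injI)
  then have "strict_mono K \<or> strict_antimono_on UNIV K"
    using injective_eq_monotone_map[of UNIV K] K by (simp add: circle_lift_def)
  then have "strict_mono (\<lambda>x. K (K x))" by (auto simp: monotone_on_def)
  moreover have "circle_lift (\<lambda>x. K (K x)) (\<phi> (k \<otimes>\<^bsub>G\<^esub> k))"
    using circle_lift_cong[OF circle_lift_compose[OF K K]] act.composition_rule[OF _ k k] by simp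
  ultimately show ?thesis by blast
qed

lemma circle_action_increasing_lift:
  assumes m: "m \<in> carrier G" and F: "circle_lift F (\<phi> m)" "strict_mono F"
  shows "\<exists>Fi. C1_increasing_pair UNIV F Fi"
    and "F (x + 2 * pi * of_int n) = F x + 2 * pi * of_int n"
proof -
  obtain Fi where Fi: "circle_lift Fi (\<phi> (inv\<^bsub>G\<^esub> m))" "\<And>x. F (Fi x) = x" "\<And>x. Fi (F x) = x"
    "C1_within UNIV F" "C1_within UNIV Fi"
    using circle_action_lift_inverse[OF m F(1)] by blast
  have pair: "C1_increasing_pair UNIV F Fi"
    using Fi F(2) by (simp add: C1_increasing_pair_def)
  then show "\<exists>Fi. C1_increasing_pair UNIV F Fi" by blast
  have "strict_mono Fi" using C1_increasing_pairD(6)[OF C1_increasing_pair_sym[OF pair]] .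
  then show "F (x + 2 * pi * of_int n) = F x + 2 * pi * of_int n"
    using increasing_lift_commutes_with_periods[OF F Fi(1) _ Fi(2,3)] by blast
qed

text \<open>
  Let \<open>W\<close>, \<open>S\<close>, \<open>C\<close> be increasing lifts of \<open>w = x\<^sup>2\<close>, \<open>s = v\<^sup>2\<close>, \<open>c = b\<^sup>2\<close>. Then \<open>W S W = S + 2 \<pi> k\<close> for an
  integer \<open>k\<close>, and replacing \<open>W\<^sup>2\<close> by \<open>T = W\<^sup>2 - 2 \<pi> k\<close> gives \<open>T S T = S\<close> exactly. Likewise
  \<open>C\<^sup>2 T C = T + 2 \<pi> m\<close>, and \<open>H = C\<^sup>3 - 2 \<pi> m\<close> satisfies \<open>H\<^sup>2 T H = T\<close>. Replacing a lift \<open>W\<close> by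
  \<open>W + 2 \<pi> j\<close> changes \<open>k\<close> by \<open>2 j\<close>, and replacing \<open>C\<close> by \<open>C + 2 \<pi> j\<close> changes \<open>m\<close> by \<open>3 j\<close>, which is why a square
  and a cube are taken.
\<close>

lemma obstruction_trivial_on_circle:
  assumes ob: "smooth_obstruction G g v x b f"
    and carr: "v \<in> carrier G" "x \<in> carrier G" "b \<in> carrier G" "f \<in> carrier G" "g \<in> carrier G"
    and y: "y \<in> unit_circle"
  shows "\<phi> g y = y"
proof (rule obstruction_trivial_if_power_trivial[OF action ob carr _ y])
  fix y :: complex assume y: "y \<in> unit_circle"
  define w where "w = x \<otimes>\<^bsub>G\<^esub> x"
  define s where "s = v \<otimes>\<^bsub>G\<^esub> v"
  define c where "c = b \<otimes>\<^bsub>G\<^esub> b"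
  define h where "h = b [^]\<^bsub>G\<^esub> (6::nat)"
  have memb: "w \<in> carrier G" "s \<in> carrier G" "c \<in> carrier G" "h \<in> carrier G"
    using carr by (simp_all add: w_def s_def c_def h_def)
  note rels = smooth_obstruction_relations[OF ob carr(1-3), folded w_def s_def c_def h_def]
  obtain W where W: "circle_lift W (\<phi> w)" "strict_mono W"
    using circle_action_square_has_increasing_lift[OF carr(2)] by (auto simp: w_def)
  obtain S where S: "circle_lift S (\<phi> s)" "strict_mono S"
    using circle_action_square_has_increasing_lift[OF carr(1)] by (auto simp: s_def)
  obtain C where C: "circle_lift C (\<phi> c)" "strict_mono C"
    using circle_action_square_has_increasing_lift[OF carr(3)] by (auto simp: c_def)
  note perW = circle_action_increasing_lift(2)[OF memb(1) W]
    and perS = circle_action_increasing_lift(2)[OF memb(2) S]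
    and perC = circle_action_increasing_lift(2)[OF memb(3) C]
  have compose: "circle_lift (\<lambda>x. F (K x)) (\<phi> (m \<otimes>\<^bsub>G\<^esub> k))"
    if "circle_lift F (\<phi> m)" "circle_lift K (\<phi> k)" "m \<in> carrier G" "k \<in> carrier G" for F K m k
    using circle_lift_cong[OF circle_lift_compose[OF that(1,2)]] act.composition_rule that(3,4) by simp

  \<comment> \<open>The relations lift up to a period, which is absorbed by translating the lifts of \<open>w\<^sup>2\<close> and \<open>c\<^sup>3\<close>.\<close>
  have "circle_lift (\<lambda>x. W (S (W x))) (\<phi> s)"
    using compose[OF compose[OF W(1) S(1)] W(1)] memb rels(1) by simp
  then obtain k :: int where k: "\<And>x. W (S (W x)) = S x + 2 * pi * k"
    using circle_lifts_differ_by_period[OF _ S(1)] by blast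
  define T where "T x = W (W x) + 2 * pi * of_int (- k)" for x
  have T: "circle_lift T (\<phi> (w \<otimes>\<^bsub>G\<^esub> w))" "strict_mono T"
  proof -
    show "circle_lift T (\<phi> (w \<otimes>\<^bsub>G\<^esub> w))"
      unfolding T_def by (rule circle_lift_shift[OF compose[OF W(1) W(1) memb(1,1)]])
    show "strict_mono T" using W(2) by (simp add: T_def strict_mono_def)
  qed
  have ww: "w \<otimes>\<^bsub>G\<^esub> w \<in> carrier G" using memb by simp
  note perT = circle_action_increasing_lift(2)[OF ww T]
  have ST: "T (S (T x)) = S x" for x
  proof -
    have "T (S (T x)) = W (W (S (W (W x)))) + 2 * pi * of_int (- k) + 2 * pi * of_int (- k)"
      by (simp only: T_def perS perW)
    also have "W (W (S (W (W x)))) = W (S (W x) + 2 * pi * k)" by (simp only: k)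
    also have "\<dots> = S x + 2 * pi * k + 2 * pi * k" by (simp only: perW k)
    finally show ?thesis by simp
  qed
  have "circle_lift (\<lambda>x. C (C (T (C x)))) (\<phi> (w \<otimes>\<^bsub>G\<^esub> w))"
    using compose[OF compose[OF compose[OF C(1) C(1)] T(1)] C(1)] memb rels(2) by simp
  then obtain m :: int where m: "\<And>x. C (C (T (C x))) = T x + 2 * pi * m"
    using circle_lifts_differ_by_period[OF _ T(1)] by blast
  define H where "H x = C (C (C x)) + 2 * pi * of_int (- m)" for x
  have H: "circle_lift H (\<phi> h)" "strict_mono H"
  proof -
    have "circle_lift (\<lambda>x. C (C (C x))) (\<phi> h)"
      using compose[OF compose[OF C(1) C(1)] C(1)] memb rels(3) by simp
    then show "circle_lift H (\<phi> h)" unfolding H_def by (rule circle_lift_shift)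
    show "strict_mono H" using C(2) by (simp add: H_def strict_mono_def)
  qed
  have HT: "H (H (T (H x))) = T x" for x
  proof -
    have "H (H (T (H x))) = C (C (C (C (C (C (T (C (C (C x))))))))) +
        2 * pi * of_int (- m) + 2 * pi * of_int (- m) + 2 * pi * of_int (- m)"
      by (simp only: H_def perC perT)
    also have "C (C (C (C (C (C (T (C (C (C x))))))))) =
        T x + 2 * pi * m + 2 * pi * m + 2 * pi * m"
      by (simp only: m perC)
    finally show ?thesis by simp
  qed

  obtain Hi where Hi: "C1_increasing_pair UNIV H Hi"
    using circle_action_increasing_lift(1)[OF memb(4) H] by blast
  obtain Ti where Ti: "C1_increasing_pair UNIV T Ti"
    using circle_action_increasing_lift(1)[OF ww T] by blast
  obtain Si where Si: "C1_increasing_pair UNIV S Si"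
    using circle_action_increasing_lift(1)[OF memb(2) S] by blast
  obtain q where q: "T q = q"
    using fixed_point_beyond_if_conjugate_to_inverse[OF is_interval_univ Ti Si ST UNIV_I] by blast
  have "y = cis (Arg2pi y)" using y complex_norm_eq_1_exp[of y] by (simp add: cis_conv_exp)
  then obtain \<theta> where \<theta>: "y = cis \<theta>" by blast
  \<comment> \<open>The largest translate of \<open>q\<close> by a period that does not exceed \<open>\<theta>\<close>.\<close>
  define p where "p = q + 2 * pi * of_int \<lfloor>(\<theta> - q) / (2 * pi)\<rfloor>"
  have "T p = p" by (simp add: p_def perT q)
  moreover have "p \<le> \<theta>"
  proof -
    have "2 * pi * of_int \<lfloor>(\<theta> - q) / (2 * pi)\<rfloor> \<le> 2 * pi * ((\<theta> - q) / (2 * pi))"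
      by (intro mult_left_mono) auto
    then show ?thesis by (simp add: p_def)
  qed
  ultimately have "H \<theta> = \<theta>"
    using trivial_right_of_fixed_point[OF is_interval_univ Hi Ti Si HT ST] by blast
  then show "\<phi> (b [^]\<^bsub>G\<^esub> (6::nat)) y = y"
    using H(1) unfolding circle_lift_def \<theta> h_def by metis
qed

end

section \<open>Local indicability through homomorphisms to the integers\<close>

lemma (in group) infinite_cyclic_group_iso_integers:
  assumes "cyclic_group G" "infinite (carrier G)"
  shows "integer_group \<cong> G"
proof -
  obtain c where c: "c \<in> carrier G" "subgroup_generated G {c} = G"
    using assms(1) by (auto simp: cyclic_group_def)
  have "inj (\<lambda>n::int. c [^] n)"
    using infinite_cyclic_subgroup_int[OF c(1)] assms(2) c(2) by (simp add: inj_def)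
  moreover have "carrier G = range (\<lambda>n::int. c [^] n)"
    using carrier_subgroup_generated_by_singleton[OF c(1)] c(2) by simp
  ultimately have "(\<lambda>n::int. c [^] n) \<in> iso integer_group G"
    using hom_integer_group_pow[OF c(1)] by (simp add: iso_def bij_betw_def)
  then show ?thesis by (auto simp: is_iso_def)
qed

definition has_integer_character :: "('a, 'b) monoid_scheme \<Rightarrow> bool" where
  "has_integer_character K \<longleftrightarrow> (\<exists>h\<in>hom K integer_group. \<exists>x\<in>carrier K. h x \<noteq> 0)"

lemma (in group) infinite_cyclic_quotient_iff_integer_character:
  "(\<exists>N. N \<lhd> G \<and> cyclic_group (G Mod N) \<and> infinite (carrier (G Mod N))) \<longleftrightarrow>
    has_integer_character G"
proof
  assume "\<exists>N. N \<lhd> G \<and> cyclic_group (G Mod N) \<and> infinite (carrier (G Mod N))"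
  then obtain N where N: "N \<lhd> G" "cyclic_group (G Mod N)" "infinite (carrier (G Mod N))" by blast
  interpret N: normal N G by (rule N(1))
  interpret Q: group "G Mod N" by (rule N.factorgroup_is_group)
  obtain k where k: "k \<in> iso (G Mod N) integer_group"
    using Q.infinite_cyclic_group_iso_integers[OF N(2,3)] group.iso_sym group_integer_group
    by (metis ex_in_conv is_iso_def)
  have hom: "(\<lambda>x. k (r_coset G N x)) \<in> hom G integer_group"
  proof -
    have "k \<in> hom (G Mod N) integer_group" using k by (simp add: iso_def)
    from Group.hom_compose[OF N.r_coset_hom_Mod this] show ?thesis by (simp add: o_def)
  qed
  have "1 \<in> k ` carrier (G Mod N)" using k by (auto simp: iso_def bij_betw_def)
  then obtain x where "x \<in> carrier G" "k (r_coset G N x) = 1" by (auto simp: carrier_FactGroup)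
  then show "has_integer_character G"
    unfolding has_integer_character_def using hom by (intro bexI[OF _ hom] bexI[of _ x]) auto
next
  assume "has_integer_character G"
  then obtain h x where h: "h \<in> hom G integer_group" and x: "x \<in> carrier G" "h x \<noteq> 0"
    by (auto simp: has_integer_character_def)
  interpret h: group_hom G integer_group h
    using h by (simp add: group_hom_def group_hom_axioms_def is_group)
  \<comment> \<open>The image of \<open>h\<close> is \<open>d\<int>\<close> for its least positive element \<open>d\<close>; dividing by \<open>d\<close> makes \<open>h\<close> surjective.\<close>
  define P where "P n \<longleftrightarrow> 0 < n \<and> (\<exists>y\<in>carrier G. h y = int n)" for n
  have "P (nat \<bar>h x\<bar>)"
    using x h.hom_inv[OF x(1)] by (auto simp: P_def abs_if intro: bexI[of _ "inv x"])
  then obtain d where d: "P d" "\<And>n. P n \<Longrightarrow> d \<le> n" by (metis LeastI Least_le)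
  obtain y where y: "y \<in> carrier G" "h y = int d" and "d > 0" using d(1) by (auto simp: P_def)
  have dvd: "int d dvd h z" if z: "z \<in> carrier G" for z
  proof (rule ccontr)
    assume "\<not> int d dvd h z"
    then have pos: "0 < h z mod int d" using \<open>d > 0\<close> by (simp add: dvd_eq_mod_eq_0 le_neq_trans)
    have "h (z \<otimes> inv (y [^] (h z div int d))) = h z mod int d"
      using z y by (simp add: h.hom_int_pow minus_div_mult_eq_mod)
    then have "P (nat (h z mod int d))"
      using z y pos by (auto simp: P_def intro: bexI[of _ "z \<otimes> inv (y [^] (h z div int d))"])
    then have "int d \<le> h z mod int d" using d(2) pos by force
    then show False using pos_mod_bound[of "int d" "h z"] \<open>d > 0\<close> by linarith
  qed
  define k where "k z = h z div int d" for z
  have k: "k \<in> hom G integer_group"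
    using h.hom_mult dvd by (intro homI) (auto simp: k_def)
  interpret k: group_hom G integer_group k
    using k by (simp add: group_hom_def group_hom_axioms_def is_group)
  have "k (y [^] n) = n" for n :: int
    using y \<open>d > 0\<close> by (simp add: k_def h.hom_int_pow)
  then have "k ` carrier G = carrier integer_group"
    using y(1) by (auto intro!: image_eqI[of _ k "y [^] _"])
  then have iso: "G Mod kernel G integer_group k \<cong> integer_group" by (rule k.FactGroup_iso)
  have "kernel G integer_group k \<lhd> G" by (rule k.normal_kernel)
  moreover from this have grp: "group (G Mod kernel G integer_group k)" by (rule normal.factorgroup_is_group)
  then have "cyclic_group (G Mod kernel G integer_group k)"
    using isomorphic_group_cyclicity[OF iso] by simp
  moreover have "infinite (carrier (G Mod kernel G integer_group k))"
    using iso bij_betw_finite infinite_UNIV_int by (fastforce simp: is_iso_def iso_def)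
  ultimately show "\<exists>N. N \<lhd> G \<and> cyclic_group (G Mod N) \<and> infinite (carrier (G Mod N))" by blast
qed

lemma (in group) locally_indicable_iff:
  "locally_indicable G \<longleftrightarrow>
    (\<forall>S. finite S \<and> S \<subseteq> carrier G \<and> \<not> S \<subseteq> {\<one>} \<longrightarrow> has_integer_character (subgroup_generated G S))"
proof -
  have "trivial_group (subgroup_generated G S) \<longleftrightarrow> S \<subseteq> {\<one>}" if "S \<subseteq> carrier G" for S
    using that by (simp add: trivial_group_subgroup_generated_eq inf.absorb2)
  then show ?thesis
    unfolding locally_indicable_def
    using group.infinite_cyclic_quotient_iff_integer_character[OF group_subgroup_generated] by auto
qed

text \<open>
  The common step of all proofs of local indicability below: to treat a finitely generated subgroup it suffices to
  map it, not necessarily injectively, to a locally indicable group with nontrivial image.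
\<close>

lemma integer_character_pullback:
  assumes "group G" "group A" "locally_indicable A" "finite S" "S \<subseteq> carrier G"
    and \<pi>: "\<pi> \<in> hom (subgroup_generated G S) A" "\<not> \<pi> ` S \<subseteq> {\<one>\<^bsub>A\<^esub>}"
  shows "has_integer_character (subgroup_generated G S)"
proof -
  interpret G: group G by fact
  interpret A: group A by fact
  let ?K = "subgroup_generated G S"
  interpret \<pi>: group_hom ?K A \<pi>
    using \<pi> by (simp add: group_hom_def group_hom_axioms_def A.is_group)
  have S: "S \<subseteq> carrier ?K" using assms by (simp add: G.subgroup_generated_subset_carrier_subset)
  then have "\<pi> ` S \<subseteq> carrier A" by auto
  then have "has_integer_character (subgroup_generated A (\<pi> ` S))"
    using assms A.locally_indicable_iff by simp
  then obtain h y where h: "h \<in> hom (subgroup_generated A (\<pi> ` S)) integer_group"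
    "y \<in> carrier (subgroup_generated A (\<pi> ` S))" "h y \<noteq> 0"
    by (auto simp: has_integer_character_def)
  have "\<pi> \<in> hom (subgroup_generated ?K S) (subgroup_generated A (\<pi> ` S))"
    by (rule \<pi>.hom_between_subgroups) simp
  then have "h \<circ> \<pi> \<in> hom ?K integer_group" using hom_compose h(1) by fastforce
  moreover obtain z where "z \<in> carrier ?K" "y = \<pi> z"
    using \<pi>.subgroup_generated_by_image[OF S] h(2) by auto
  ultimately show ?thesis
    using h(3) unfolding has_integer_character_def by (intro bexI[of _ "h \<circ> \<pi>"] bexI[of _ z]) auto
qed

lemma locally_indicable_if_embeds:
  assumes "group G" "group A" "locally_indicable A" "\<iota> \<in> hom G A" "inj_on \<iota> (carrier G)"
  shows "locally_indicable G"
proof -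
  interpret G: group G by fact
  interpret \<iota>: group_hom G A \<iota>
    using assms by (simp add: group_hom_def group_hom_axioms_def)
  show ?thesis
    unfolding G.locally_indicable_iff
  proof (intro allI impI)
    fix S assume S: "finite S \<and> S \<subseteq> carrier G \<and> \<not> S \<subseteq> {\<one>\<^bsub>G\<^esub>}"
    then obtain s where s: "s \<in> S" "s \<noteq> \<one>\<^bsub>G\<^esub>" "s \<in> carrier G" by auto
    then have "\<iota> s \<noteq> \<one>\<^bsub>A\<^esub>" using assms(5) by (metis G.one_closed \<iota>.hom_one inj_onD)
    then have "\<not> \<iota> ` S \<subseteq> {\<one>\<^bsub>A\<^esub>}" using s by auto
    then show "has_integer_character (subgroup_generated G S)"
      using integer_character_pullback[OF assms(1-3), of S \<iota>] G.hom_from_subgroup_generated[OF assms(4)] S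
      by blast
  qed
qed

lemma locally_indicable_integer_group: "locally_indicable integer_group"
proof -
  interpret Z: group integer_group by simp
  show ?thesis
    unfolding Z.locally_indicable_iff has_integer_character_def
  proof (intro allI impI)
    fix S :: "int set"
    assume S: "finite S \<and> S \<subseteq> carrier integer_group \<and> \<not> S \<subseteq> {\<one>\<^bsub>integer_group\<^esub>}"
    then obtain s where "s \<in> S" "s \<noteq> 0" by auto
    moreover have "(\<lambda>x. x) \<in> hom (subgroup_generated integer_group S) integer_group"
      by (simp add: hom_def)
    ultimately show "\<exists>h\<in>hom (subgroup_generated integer_group S) integer_group.
        \<exists>x\<in>carrier (subgroup_generated integer_group S). h x \<noteq> 0"
      using Z.subgroup_generated_subset_carrier_subset[of S] by (intro bexI) auto
  qed
qed

definition rational_group :: "rat monoid" where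
  "rational_group = \<lparr>carrier = UNIV, monoid.mult = (+), one = 0\<rparr>"

lemma rational_group_simps [simp]:
  "carrier rational_group = UNIV" "x \<otimes>\<^bsub>rational_group\<^esub> y = x + y" "\<one>\<^bsub>rational_group\<^esub> = 0"
  by (simp_all add: rational_group_def)

lemma group_rational_group [simp]: "group rational_group"
  by (rule groupI) (auto simp: rational_group_def intro: exI[of _ "- _"])

lemma common_denominator:
  assumes "finite (S :: rat set)"
  shows "\<exists>n::int. n > 0 \<and> (\<forall>s\<in>S. of_int n * s \<in> \<int>)"
  using assms
proof (induction S)
  case empty
  then show ?case by (intro exI[of _ 1]) auto
next
  case (insert s S)
  then obtain n :: int where n: "n > 0" "\<forall>s\<in>S. of_int n * s \<in> \<int>" by auto
  obtain a b where ab: "quotient_of s = (a, b)" by fastforce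
  then have b: "b > 0" "s = of_int a / of_int b" by (auto simp: quotient_of_denom_pos quotient_of_div)
  have "of_int (n * b) * r \<in> \<int>" if "r \<in> insert s S" for r
  proof (cases "r = s")
    case True
    then have "of_int (n * b) * r = of_int (n * a)" using b by (simp add: field_simps)
    then show ?thesis by (metis Ints_of_int)
  next
    case False
    then have "of_int n * r \<in> \<int>" using n(2) that by blast
    then have "of_int b * (of_int n * r) \<in> \<int>" by (rule Ints_mult[OF Ints_of_int])
    then show ?thesis by (simp add: mult_ac)
  qed
  then show ?case using n(1) b(1) by (intro exI[of _ "n * b"]) auto
qed

text \<open>
  Multiplication by a common denominator maps a finitely generated subgroup of \<open>\<rat>\<close> to \<open>\<int>\<close>.
\<close>

lemma locally_indicable_rational_group: "locally_indicable rational_group"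
proof -
  interpret Q: group rational_group by simp
  show ?thesis
    unfolding Q.locally_indicable_iff
  proof (intro allI impI)
    fix S :: "rat set"
    assume S: "finite S \<and> S \<subseteq> carrier rational_group \<and> \<not> S \<subseteq> {\<one>\<^bsub>rational_group\<^esub>}"
    then obtain n :: int where n: "n > 0" "\<And>s. s \<in> S \<Longrightarrow> of_int n * s \<in> \<int>"
      using common_denominator by blast
    have inv_eq: "inv\<^bsub>rational_group\<^esub> y = - y" for y by (rule Q.inv_equality) auto
    have int: "of_int n * y \<in> \<int>" if "y \<in> carrier (subgroup_generated rational_group S)" for y
    proof -
      have "y \<in> generate rational_group S" using that by (simp add: carrier_subgroup_generated)
      then show ?thesis
        by (induction rule: generate.induct) (auto simp: n inv_eq distrib_left)
    qed
    have hom: "(\<lambda>y. \<lfloor>of_int n * y\<rfloor>) \<in> hom (subgroup_generated rational_group S) integer_group"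
    proof (rule homI)
      fix y z assume "y \<in> carrier (subgroup_generated rational_group S)"
        "z \<in> carrier (subgroup_generated rational_group S)"
      from int[OF this(1)] int[OF this(2)]
      show "\<lfloor>of_int n * (y \<otimes>\<^bsub>subgroup_generated rational_group S\<^esub> z)\<rfloor> =
          \<lfloor>of_int n * y\<rfloor> \<otimes>\<^bsub>integer_group\<^esub> \<lfloor>of_int n * z\<rfloor>"
        by (auto simp: distrib_left elim!: Ints_cases simp flip: of_int_add)
    qed simp
    obtain s where s: "s \<in> S" "s \<noteq> 0" using S by auto
    have nonzero: "\<lfloor>of_int n * s\<rfloor> \<noteq> 0"
    proof
      assume "\<lfloor>of_int n * s\<rfloor> = 0"
      then have "of_int n * s = 0" using n(2)[OF s(1)] by (auto elim!: Ints_cases)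
      then show False using s(2) n(1) by simp
    qed
    have "s \<in> carrier (subgroup_generated rational_group S)"
      using Q.subgroup_generated_subset_carrier_subset[of S] s by auto
    with nonzero show "has_integer_character (subgroup_generated rational_group S)"
      unfolding has_integer_character_def by (intro bexI[OF _ hom] bexI[of _ s])
  qed
qed

section \<open>Unrestricted wreath products\<close>

text \<open>
  All functions are admitted in the base, not just those of finite support: the commutator
  construction below uses a function supported on the infinite set of powers of an element. The
  formula describes the wreath product for groups whose carrier is the whole type.
\<close>

definition wreath ::
    "('g, 'm) monoid_scheme \<Rightarrow> ('a, 'n) monoid_scheme \<Rightarrow> (('a \<Rightarrow> 'g) \<times> 'a) monoid" where
  "wreath G A = \<lparr>carrier = UNIV,
     monoid.mult = (\<lambda>(f, a) (h, b). (\<lambda>x. f x \<otimes>\<^bsub>G\<^esub> h (inv\<^bsub>A\<^esub> a \<otimes>\<^bsub>A\<^esub> x), a \<otimes>\<^bsub>A\<^esub> b)),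
     one = (\<lambda>_. \<one>\<^bsub>G\<^esub>, \<one>\<^bsub>A\<^esub>)\<rparr>"

lemma wreath_simps [simp]:
  "carrier (wreath G A) = UNIV" "\<one>\<^bsub>wreath G A\<^esub> = (\<lambda>_. \<one>\<^bsub>G\<^esub>, \<one>\<^bsub>A\<^esub>)"
  "(f, a) \<otimes>\<^bsub>wreath G A\<^esub> (h, b) = (\<lambda>x. f x \<otimes>\<^bsub>G\<^esub> h (inv\<^bsub>A\<^esub> a \<otimes>\<^bsub>A\<^esub> x), a \<otimes>\<^bsub>A\<^esub> b)"
  by (simp_all add: wreath_def)

locale wreath_product = base: group G + top: group A
  for G :: "('g, 'm) monoid_scheme" and A :: "('a, 'n) monoid_scheme" +
  assumes full [simp]: "carrier G = UNIV" "carrier A = UNIV"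
begin

lemma base_closed [simp]: "y \<in> carrier G" and top_closed [simp]: "a \<in> carrier A"
  by simp_all

lemma group_wreath: "group (wreath G A)"
proof (rule groupI)
  fix p q r :: "('a \<Rightarrow> 'g) \<times> 'a"
  show "p \<otimes>\<^bsub>wreath G A\<^esub> q \<otimes>\<^bsub>wreath G A\<^esub> r = p \<otimes>\<^bsub>wreath G A\<^esub> (q \<otimes>\<^bsub>wreath G A\<^esub> r)"
    by (cases p; cases q; cases r) (simp add: base.m_assoc top.m_assoc top.inv_mult_group)
  show "\<one>\<^bsub>wreath G A\<^esub> \<otimes>\<^bsub>wreath G A\<^esub> p = p" by (cases p) simp
  obtain f a where p: "p = (f, a)" by fastforce
  show "\<exists>q\<in>carrier (wreath G A). q \<otimes>\<^bsub>wreath G A\<^esub> p = \<one>\<^bsub>wreath G A\<^esub>"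
    by (rule bexI[of _ "(\<lambda>x. inv\<^bsub>G\<^esub> f (a \<otimes>\<^bsub>A\<^esub> x), inv\<^bsub>A\<^esub> a)"]) (simp_all add: p)
qed simp_all

lemma snd_hom: "snd \<in> hom (wreath G A) A"
  by (rule homI) (auto simp: wreath_def)

text \<open>
  A finitely generated subgroup that maps nontrivially to \<open>A\<close> is handled by this projection.
  Otherwise it lies in the base, where evaluation at a suitable point of \<open>A\<close> is a nontrivial
  homomorphism to \<open>G\<close>.
\<close>

lemma locally_indicable_wreath:
  assumes "locally_indicable G" "locally_indicable A"
  shows "locally_indicable (wreath G A)"
proof -
  interpret W: group "wreath G A" by (rule group_wreath)
  interpret snd: group_hom "wreath G A" A snd
    by (simp add: group_hom_def group_hom_axioms_def W.is_group top.is_group snd_hom)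
  show ?thesis
    unfolding W.locally_indicable_iff
  proof (intro allI impI)
    fix S assume S: "finite S \<and> S \<subseteq> carrier (wreath G A) \<and> \<not> S \<subseteq> {\<one>\<^bsub>wreath G A\<^esub>}"
    then have finS: "finite S" "S \<subseteq> carrier (wreath G A)" by blast+
    let ?K = "subgroup_generated (wreath G A) S"
    show "has_integer_character ?K"
    proof (cases "snd ` S \<subseteq> {\<one>\<^bsub>A\<^esub>}")
      case False
      then show ?thesis
        using integer_character_pullback[OF group_wreath top.is_group assms(2), of S snd]
          W.hom_from_subgroup_generated[OF snd_hom] S by simp
    next
      case True
      have "carrier (subgroup_generated A (snd ` S)) = {\<one>\<^bsub>A\<^esub>}"
        using top.trivial_group_subgroup_generated[OF True] by (simp add: trivial_group_def)
      then have K: "snd p = \<one>\<^bsub>A\<^esub>" if "p \<in> carrier ?K" for p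
        using snd.subgroup_generated_by_image[of S] that by auto
      obtain f where f: "(f, \<one>\<^bsub>A\<^esub>) \<in> S" "f \<noteq> (\<lambda>_. \<one>\<^bsub>G\<^esub>)" using S True by force
      then obtain z where z: "f z \<noteq> \<one>\<^bsub>G\<^esub>" by auto
      have hom: "(\<lambda>p. fst p z) \<in> hom ?K G"
      proof (rule homI)
        fix p q assume "p \<in> carrier ?K" "q \<in> carrier ?K"
        then show "fst (p \<otimes>\<^bsub>?K\<^esub> q) z = fst p z \<otimes>\<^bsub>G\<^esub> fst q z"
          using K[of p] by (cases p; cases q) auto
      qed simp
      have nontriv: "\<not> (\<lambda>p. fst p z) ` S \<subseteq> {\<one>\<^bsub>G\<^esub>}"
        using imageI[OF f(1), of "\<lambda>p. fst p z"] z by auto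
      show ?thesis
        by (rule integer_character_pullback[OF group_wreath base.is_group assms(1) finS hom nontriv])
    qed
  qed
qed

end

section \<open>Making an element obstructed\<close>

type_synonym rational_wreath_elem = "((int \<Rightarrow> int) \<times> int \<Rightarrow> rat) \<times> ((int \<Rightarrow> int) \<times> int)"

definition rational_wreath :: "rational_wreath_elem monoid" where
  "rational_wreath = wreath rational_group (wreath integer_group integer_group)"

lemma wreath_product_integers: "wreath_product integer_group integer_group"
  by (simp add: wreath_product_def wreath_product_axioms_def)

lemma wreath_product_rationals:
  "wreath_product rational_group (wreath integer_group integer_group)"
  using wreath_product.group_wreath[OF wreath_product_integers]
  by (simp add: wreath_product_def wreath_product_axioms_def)

lemma group_rational_wreath: "group rational_wreath"
  unfolding rational_wreath_def by (rule wreath_product.group_wreath[OF wreath_product_rationals])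

lemma carrier_rational_wreath [simp]: "carrier rational_wreath = UNIV"
  by (simp add: rational_wreath_def)

lemma locally_indicable_rational_wreath: "locally_indicable rational_wreath"
  unfolding rational_wreath_def
  using wreath_product.locally_indicable_wreath[OF wreath_product_rationals
      locally_indicable_rational_group wreath_product.locally_indicable_wreath[OF wreath_product_integers
        locally_indicable_integer_group locally_indicable_integer_group]] .

lemma (in wreath_product) top_pow:
  "(\<lambda>_. \<one>\<^bsub>G\<^esub>, a) [^]\<^bsub>wreath G A\<^esub> (n::nat) = (\<lambda>_. \<one>\<^bsub>G\<^esub>, a [^]\<^bsub>A\<^esub> n)"
  by (induction n) simp_all

lemma (in wreath_product) base_pow:
  "(f, \<one>\<^bsub>A\<^esub>) [^]\<^bsub>wreath G A\<^esub> (n::nat) = (\<lambda>x. f x [^]\<^bsub>G\<^esub> n, \<one>\<^bsub>A\<^esub>)"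
  by (induction n) simp_all

lemma rational_group_pow: "y [^]\<^bsub>rational_group\<^esub> (n::nat) = of_nat n * y"
  by (induction n) (simp_all add: distrib_right)

text \<open>
  In \<open>\<int> wr \<int>\<close> take for \<open>v\<close> the shift and for \<open>x\<close> the function \<open>\<xi>\<close> with values \<open>1, 1, -1, -1\<close> repeated
  periodically, which \<open>v\<^sup>2\<close> negates. In the wreath product of \<open>\<rat>\<close> by this group, take for \<open>b\<close> a
  function \<open>\<beta>\<close> that is multiplied by \<open>-2\<close> under translation by \<open>x\<^sup>4\<close>. Such a function exists because \<open>x\<^sup>4\<close> acts
  on the values \<open>\<phi> 0\<close> by adding 4, and because its values may be divided by 2. It is nowhere
  zero, so \<open>b\<^sup>6\<close> has infinite order.
\<close>

lemma rational_wreath_relations: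
  "\<exists>v x b. x \<otimes>\<^bsub>rational_wreath\<^esub> v [^]\<^bsub>rational_wreath\<^esub> (2::nat) \<otimes>\<^bsub>rational_wreath\<^esub> x = v [^]\<^bsub>rational_wreath\<^esub> (2::nat) \<and>
    b [^]\<^bsub>rational_wreath\<^esub> (2::nat) \<otimes>\<^bsub>rational_wreath\<^esub> x [^]\<^bsub>rational_wreath\<^esub> (4::nat) \<otimes>\<^bsub>rational_wreath\<^esub> b
      = x [^]\<^bsub>rational_wreath\<^esub> (4::nat) \<and>
    (\<forall>n::nat. (b [^]\<^bsub>rational_wreath\<^esub> (6::nat)) [^]\<^bsub>rational_wreath\<^esub> n = \<one>\<^bsub>rational_wreath\<^esub> \<longrightarrow> n = 0)"
proof -
  interpret K: wreath_product integer_group integer_group by (rule wreath_product_integers)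
  interpret W: wreath_product rational_group "wreath integer_group integer_group"
    by (rule wreath_product_rationals)
  interpret W: group rational_wreath by (rule group_rational_wreath)
  let ?K = "wreath integer_group integer_group"
  define \<xi> :: "int \<Rightarrow> int" where "\<xi> n = (if even (n div 2) then 1 else -1)" for n
  define \<beta> :: "(int \<Rightarrow> int) \<times> int \<Rightarrow> rat" where "\<beta> k = (- 2) powi (- (fst k 0 div 4))" for k
  define x where "x = (\<lambda>_::(int \<Rightarrow> int) \<times> int. 0::rat, (\<xi>, 0::int))"
  define v where "v = (\<lambda>_::(int \<Rightarrow> int) \<times> int. 0::rat, (\<lambda>_::int. 0::int, 1::int))"
  define b where "b = (\<beta>, \<one>\<^bsub>?K\<^esub>)"
  have v2: "v [^]\<^bsub>rational_wreath\<^esub> (2::nat) = (\<lambda>_. 0, (\<lambda>_. 0, 2))"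
    using W.top_pow[of "(\<lambda>_. 0, 1)" 2] K.top_pow[of 1 2] by (simp add: v_def rational_wreath_def)
  have \<xi>_shift: "\<xi> n + \<xi> (n - 2) = 0" for n
  proof -
    have "(n - 2) div 2 = n div 2 - 1" by simp
    then show ?thesis by (simp add: \<xi>_def)
  qed
  have xv: "x \<otimes>\<^bsub>rational_wreath\<^esub> v [^]\<^bsub>rational_wreath\<^esub> (2::nat) \<otimes>\<^bsub>rational_wreath\<^esub> x = v [^]\<^bsub>rational_wreath\<^esub> (2::nat)"
    unfolding v2 using \<xi>_shift by (simp add: x_def rational_wreath_def)
  have x4: "x [^]\<^bsub>rational_wreath\<^esub> (4::nat) = (\<lambda>_. 0, (\<lambda>n. 4 * \<xi> n, 0))"
    using W.top_pow[of "(\<xi>, 0)" 4] K.base_pow[of \<xi> 4] by (simp add: x_def rational_wreath_def)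
  have inv_x4: "inv\<^bsub>?K\<^esub> (\<lambda>n. 4 * \<xi> n, 0) = (\<lambda>n. - 4 * \<xi> n, 0)"
    by (rule W.top.inv_equality) auto
  have b_pow: "b [^]\<^bsub>rational_wreath\<^esub> (n::nat) = (\<lambda>k. of_nat n * \<beta> k, \<one>\<^bsub>?K\<^esub>)" for n
    using W.base_pow[of \<beta> n] by (simp add: b_def rational_wreath_def rational_group_pow del: wreath_simps(2))
  have \<beta>_shift: "\<beta> ((\<lambda>n. - 4 * \<xi> n, 0) \<otimes>\<^bsub>?K\<^esub> k) = - 2 * \<beta> k" for k
  proof (cases k)
    case (Pair \<phi> m)
    have "(\<phi> 0 - 4) div 4 = \<phi> 0 div 4 - 1" by simp
    moreover have "(- 2 :: rat) powi (1 - \<phi> 0 div 4) = - 2 * (- 2) powi (- (\<phi> 0 div 4))"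
      using power_int_add[of "- 2 :: rat" 1 "- (\<phi> 0 div 4)"] by simp
    ultimately show ?thesis by (simp add: Pair \<beta>_def \<xi>_def)
  qed
  have bx: "b [^]\<^bsub>rational_wreath\<^esub> (2::nat) \<otimes>\<^bsub>rational_wreath\<^esub> x [^]\<^bsub>rational_wreath\<^esub> (4::nat) \<otimes>\<^bsub>rational_wreath\<^esub> b
      = x [^]\<^bsub>rational_wreath\<^esub> (4::nat)"
    unfolding x4 b_pow unfolding b_def rational_wreath_def wreath_simps(3)
    using \<beta>_shift inv_x4 by simp
  have ord: "n = 0" if "(b [^]\<^bsub>rational_wreath\<^esub> (6::nat)) [^]\<^bsub>rational_wreath\<^esub> n = \<one>\<^bsub>rational_wreath\<^esub>" for n :: nat
  proof -
    have "b [^]\<^bsub>rational_wreath\<^esub> (6 * n) = \<one>\<^bsub>rational_wreath\<^esub>" using that by (simp add: W.nat_pow_pow)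
    from arg_cong[OF this[unfolded b_pow], of "\<lambda>p. fst p (\<lambda>_. 0, 0)"]
    have "of_nat (6 * n) * \<beta> (\<lambda>_. 0, 0) = 0" by (simp add: rational_wreath_def)
    then show ?thesis by (simp add: \<beta>_def)
  qed
  show ?thesis using xv bx ord by blast
qed

text \<open>
  If \<open>h\<close> has infinite order and \<open>f\<close> is the function with value \<open>g\<close> at the powers \<open>h\<^sup>n\<close>, \<open>n \<ge> 0\<close>, then
  \<open>h f h\<^sup>-\<^sup>1\<close> is the same function on the powers with \<open>n \<ge> 1\<close>. The quotient \<open>[f, h]\<close> is therefore
  supported at \<open>1\<close>, where its value is \<open>g\<close>.
\<close>

lemma locally_indicable_extension_with_obstruction:
  fixes G :: "'g monoid"
  assumes "group G" and full: "carrier G = UNIV" and li: "locally_indicable G"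
  obtains \<iota> v x b f where
    "group (wreath G rational_wreath)" "locally_indicable (wreath G rational_wreath)"
    "\<iota> \<in> hom G (wreath G rational_wreath)" "inj \<iota>"
    "smooth_obstruction (wreath G rational_wreath) (\<iota> g) v x b f"
proof -
  let ?A = rational_wreath
  let ?W = "wreath G ?A"
  interpret wreath_product G ?A
    using assms group_rational_wreath by (simp add: wreath_product_def wreath_product_axioms_def)
  interpret W: group ?W by (rule group_wreath)
  obtain v x b where rel: "x \<otimes>\<^bsub>?A\<^esub> v [^]\<^bsub>?A\<^esub> (2::nat) \<otimes>\<^bsub>?A\<^esub> x = v [^]\<^bsub>?A\<^esub> (2::nat)"
    "b [^]\<^bsub>?A\<^esub> (2::nat) \<otimes>\<^bsub>?A\<^esub> x [^]\<^bsub>?A\<^esub> (4::nat) \<otimes>\<^bsub>?A\<^esub> b = x [^]\<^bsub>?A\<^esub> (4::nat)"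
    "\<And>n::nat. (b [^]\<^bsub>?A\<^esub> (6::nat)) [^]\<^bsub>?A\<^esub> n = \<one>\<^bsub>?A\<^esub> \<Longrightarrow> n = 0"
    using rational_wreath_relations by blast
  define h where "h = b [^]\<^bsub>?A\<^esub> (6::nat)"
  define \<iota> where "\<iota> y = (\<lambda>a. if a = \<one>\<^bsub>?A\<^esub> then y else \<one>\<^bsub>G\<^esub>, \<one>\<^bsub>?A\<^esub>)" for y
  define f where "f = (\<lambda>a. if \<exists>n::nat. a = h [^]\<^bsub>?A\<^esub> n then g else \<one>\<^bsub>G\<^esub>, \<one>\<^bsub>?A\<^esub>)"
  define up where "up a = (\<lambda>_::rational_wreath_elem. \<one>\<^bsub>G\<^esub>, a)" for a :: rational_wreath_elem
  have up_pow: "up a [^]\<^bsub>?W\<^esub> (n::nat) = up (a [^]\<^bsub>?A\<^esub> n)" for a n by (simp add: up_def top_pow)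
  have up_mult: "up a \<otimes>\<^bsub>?W\<^esub> up c = up (a \<otimes>\<^bsub>?A\<^esub> c)" for a c by (simp add: up_def)
  have hom: "\<iota> \<in> hom G ?W" by (rule homI) (auto simp: \<iota>_def)
  have inj: "inj \<iota>"
  proof (rule injI)
    fix y z assume "\<iota> y = \<iota> z"
    from arg_cong[OF this, of "\<lambda>p. fst p \<one>\<^bsub>?A\<^esub>"] show "y = z" by (simp add: \<iota>_def)
  qed
  have "\<iota> g \<otimes>\<^bsub>?W\<^esub> up h \<otimes>\<^bsub>?W\<^esub> f = f \<otimes>\<^bsub>?W\<^esub> up h"
  proof -
    have "(if a = \<one>\<^bsub>?A\<^esub> then g else \<one>\<^bsub>G\<^esub>) \<otimes>\<^bsub>G\<^esub>
        (if \<exists>n::nat. inv\<^bsub>?A\<^esub> h \<otimes>\<^bsub>?A\<^esub> a = h [^]\<^bsub>?A\<^esub> n then g else \<one>\<^bsub>G\<^esub>) =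
        (if \<exists>n::nat. a = h [^]\<^bsub>?A\<^esub> n then g else \<one>\<^bsub>G\<^esub>)" for a
    proof -
      have shift: "inv\<^bsub>?A\<^esub> h \<otimes>\<^bsub>?A\<^esub> a = h [^]\<^bsub>?A\<^esub> n \<longleftrightarrow> a = h [^]\<^bsub>?A\<^esub> Suc n" for n :: nat
        using top.nat_pow_Suc2[of h n] top.inv_solve_left[of "h [^]\<^bsub>?A\<^esub> n" h a] by auto
      have "(\<exists>n::nat. a = h [^]\<^bsub>?A\<^esub> n) \<longleftrightarrow> a = \<one>\<^bsub>?A\<^esub> \<or> (\<exists>n::nat. a = h [^]\<^bsub>?A\<^esub> Suc n)"
        by (metis not0_implies_Suc top.nat_pow_0)
      moreover have "\<one>\<^bsub>?A\<^esub> \<noteq> h [^]\<^bsub>?A\<^esub> Suc n" for n :: nat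
        using rel(3)[of "Suc n"] unfolding h_def by (metis nat.distinct(1))
      ultimately show ?thesis unfolding shift by auto
    qed
    then show ?thesis by (simp add: \<iota>_def f_def up_def)
  qed
  then have ob: "smooth_obstruction ?W (\<iota> g) (up v) (up x) (up b) f"
    unfolding smooth_obstruction_def by (simp only: up_pow up_mult rel(1,2) h_def[symmetric] simp_thms)
  show thesis
    by (rule that[OF group_wreath locally_indicable_wreath[OF li locally_indicable_rational_wreath] hom inj ob])
qed

section \<open>The space of enumerated groups\<close>

lemma open_fun_finite_support:
  fixes A :: "('a \<Rightarrow> 'b::topological_space) set"
  assumes "open A" "f \<in> A"
  shows "\<exists>D. finite D \<and> (\<forall>f'. (\<forall>k\<in>D. f' k = f k) \<longrightarrow> f' \<in> A)"
proof -
  have "openin (product_topology (\<lambda>_. euclidean) UNIV) A"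
    using assms(1) by (simp add: open_fun_def)
  from product_topology_open_contains_basis[OF this assms(2)]
  obtain X where X: "f \<in> Pi\<^sub>E UNIV X" "finite {k. X k \<noteq> UNIV}" "Pi\<^sub>E UNIV X \<subseteq> A" by auto
  have "f' \<in> A" if "\<forall>k\<in>{k. X k \<noteq> UNIV}. f' k = f k" for f'
  proof -
    have "f' k \<in> X k" for k using X(1) that by (cases "X k = UNIV") (auto simp: PiE_UNIV_domain)
    then show ?thesis using X(3) by (auto simp: PiE_UNIV_domain)
  qed
  then show ?thesis using X(2) by blast
qed

lemma open_group_ops_finite_support:
  fixes V :: "group_ops set"
  assumes "open V" "(m, i, e) \<in> V"
  shows "\<exists>D. finite D \<and> (\<forall>m' i'. (\<forall>a\<in>D. \<forall>b\<in>D. m' (a, b) = m (a, b)) \<and> (\<forall>a\<in>D. i' a = i a) \<longrightarrow>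
    (m', i', e) \<in> V)"
proof -
  obtain A B where "open A" and B: "open B" and ops: "(m, i, e) \<in> A \<times> B" "A \<times> B \<subseteq> V"
    using assms by (rule open_prod_elim)
  then have A: "open A" "m \<in> A" and ie: "(i, e) \<in> B" by auto
  obtain B1 B2 where "open B1" "open B2" and B12: "(i, e) \<in> B1 \<times> B2" "B1 \<times> B2 \<subseteq> B"
    using B ie by (rule open_prod_elim)
  then have B1: "open B1" "i \<in> B1" by auto
  obtain D1 where D1: "finite D1" "\<And>m'. (\<forall>k\<in>D1. m' k = m k) \<Longrightarrow> m' \<in> A"
    using open_fun_finite_support[OF A] by blast
  obtain D2 where D2: "finite D2" "\<And>i'. (\<forall>k\<in>D2. i' k = i k) \<Longrightarrow> i' \<in> B1"
    using open_fun_finite_support[OF B1] by blast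
  let ?D = "fst ` D1 \<union> snd ` D1 \<union> D2"
  have "(m', i', e) \<in> V" if "\<forall>a\<in>?D. \<forall>b\<in>?D. m' (a, b) = m (a, b)" "\<forall>a\<in>?D. i' a = i a" for m' i'
  proof -
    have "m' \<in> A" using that(1) by (intro D1(2)) force
    moreover have "i' \<in> B1" using that(2) by (intro D2(2)) auto
    ultimately show ?thesis using ops B12 by blast
  qed
  then show ?thesis using D1(1) D2(1) by (intro exI[of _ ?D]) auto
qed

lemma group_of_ops_simps [simp]:
  "carrier (group_of_ops p) = UNIV" "a \<otimes>\<^bsub>group_of_ops p\<^esub> b = fst p (a, b)"
  "\<one>\<^bsub>group_of_ops p\<^esub> = snd (snd p)"
  by (simp_all add: group_of_ops_def split: prod.split)

text \<open>
  Continuity of a function to the discrete space of natural numbers, in the form in which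
  it passes to composite terms of the group language.
\<close>

definition locally_constant :: "(group_ops \<Rightarrow> nat) \<Rightarrow> bool" where
  "locally_constant E \<longleftrightarrow> (\<forall>a. open {p. E p = a})"

lemma locally_constant_const: "locally_constant (\<lambda>_. a)"
  by (simp add: locally_constant_def)

lemma locally_constant_mult:
  assumes "locally_constant E" "locally_constant E'"
  shows "locally_constant (\<lambda>p. E p \<otimes>\<^bsub>group_of_ops p\<^esub> E' p)"
  unfolding locally_constant_def
proof
  fix a
  have "continuous_on UNIV (\<lambda>p :: group_ops. fst p (b, c))" for b c
    by (rule continuous_on_product_then_coordinatewise) (intro continuous_intros)
  then have "open ((\<lambda>p :: group_ops. fst p (b, c)) -` {a})" for b c
    using continuous_on_open_vimage[OF open_UNIV] open_discrete by (metis Int_UNIV_right)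
  then have "open (\<Union>b. \<Union>c. {p. E p = b} \<inter> {p. E' p = c} \<inter> ((\<lambda>p. fst p (b, c)) -` {a}))"
    using assms by (intro open_UN ballI open_Int) (auto simp: locally_constant_def)
  moreover have "{p. E p \<otimes>\<^bsub>group_of_ops p\<^esub> E' p = a} =
      (\<Union>b. \<Union>c. {p. E p = b} \<inter> {p. E' p = c} \<inter> ((\<lambda>p. fst p (b, c)) -` {a}))"
    by auto
  ultimately show "open {p. E p \<otimes>\<^bsub>group_of_ops p\<^esub> E' p = a}" by simp
qed

lemma locally_constant_one: "locally_constant (\<lambda>p. \<one>\<^bsub>group_of_ops p\<^esub>)"
proof -
  have "continuous_on UNIV (\<lambda>p :: group_ops. snd (snd p))" by (intro continuous_intros)
  then have "open ((\<lambda>p :: group_ops. snd (snd p)) -` {a})" for a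
    using continuous_on_open_vimage[OF open_UNIV] open_discrete by (metis Int_UNIV_right)
  then show ?thesis by (simp add: locally_constant_def vimage_def)
qed

lemma locally_constant_pow:
  assumes "locally_constant E"
  shows "locally_constant (\<lambda>p. E p [^]\<^bsub>group_of_ops p\<^esub> (n::nat))"
proof (induction n)
  case 0
  then show ?case using locally_constant_one by (simp add: nat_pow_def)
next
  case (Suc n)
  have "E p [^]\<^bsub>group_of_ops p\<^esub> Suc n = E p [^]\<^bsub>group_of_ops p\<^esub> n \<otimes>\<^bsub>group_of_ops p\<^esub> E p" for p
    by (simp add: nat_pow_def)
  then show ?case using locally_constant_mult[OF Suc assms] by simp
qed

lemma open_Collect_locally_constant_eq:
  assumes "locally_constant E" "locally_constant E'"
  shows "open {p. E p = E' p}"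
proof -
  have "open (\<Union>a. {p. E p = a} \<inter> {p. E' p = a})"
    using assms by (intro open_UN ballI open_Int) (auto simp: locally_constant_def)
  moreover have "{p. E p = E' p} = (\<Union>a. {p. E p = a} \<inter> {p. E' p = a})" by auto
  ultimately show ?thesis by simp
qed

lemma open_smooth_obstruction:
  "open {p. \<exists>v x b f. smooth_obstruction (group_of_ops p) g v x b f}"
  unfolding smooth_obstruction_def
  by (intro open_Collect_ex open_Collect_conj open_Collect_locally_constant_eq locally_constant_mult
      locally_constant_pow locally_constant_const)

section \<open>Density\<close>

lemma (in group) countable_generate:
  assumes "countable S" "S \<subseteq> carrier G"
  shows "countable (generate G S)"
proof -
  \<comment> \<open>Every element of the generated subgroup is a word in the generators and their inverses.\<close>
  let ?T = "S \<union> m_inv G ` S"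
  let ?prod = "\<lambda>xs. foldr (\<otimes>) xs \<one>"
  have T: "?T \<subseteq> carrier G" using assms(2) by auto
  have closed: "?prod xs \<in> carrier G" if "set xs \<subseteq> ?T" for xs
    using that T by (induction xs) auto
  have append: "?prod (xs @ ys) = ?prod xs \<otimes> ?prod ys" if "set xs \<subseteq> ?T" "set ys \<subseteq> ?T" for xs ys
    using that(1)
  proof (induction xs)
    case Nil
    then show ?case using closed[OF that(2)] by simp
  next
    case (Cons a xs)
    then have "a \<in> carrier G" "?prod xs \<in> carrier G" using T closed[of xs] by auto
    then show ?case using Cons closed[OF that(2)] by (simp add: m_assoc)
  qed
  have "generate G S \<subseteq> ?prod ` {xs. set xs \<subseteq> ?T}"
  proof
    fix y assume "y \<in> generate G S"
    then show "y \<in> ?prod ` {xs. set xs \<subseteq> ?T}"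
    proof (induction rule: generate.induct)
      case one
      then show ?case by (intro image_eqI[of _ _ "[]"]) auto
    next
      case (incl h)
      then show ?case using assms(2) by (intro image_eqI[of _ _ "[h]"]) auto
    next
      case (inv h)
      then show ?case using assms(2) by (intro image_eqI[of _ _ "[inv h]"]) auto
    next
      case (eng h1 h2)
      then obtain xs ys where "set xs \<subseteq> ?T" "set ys \<subseteq> ?T" "h1 = ?prod xs" "h2 = ?prod ys" by blast
      then show ?case using append[of xs ys] by (intro image_eqI[of _ _ "xs @ ys"]) auto
    qed
  qed
  moreover have "countable {xs. set xs \<subseteq> ?T}"
    using countable_lists[of ?T] assms(1) by (simp add: lists_eq_set)
  ultimately show ?thesis by (meson countable_image countable_subset)
qed

lemma bij_betw_extending_finite:
  fixes \<iota> :: "nat \<Rightarrow> 'b"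
  assumes "inj \<iota>" "range \<iota> \<subseteq> H" "countable H" "finite D"
  shows "\<exists>\<beta>. bij_betw \<beta> UNIV H \<and> (\<forall>n\<in>D. \<beta> n = \<iota> n)"
proof -
  have inf: "infinite H" using assms(1,2) by (meson finite_subset range_inj_infinite)
  have "bij_betw (from_nat_into (H - \<iota> ` D)) UNIV (H - \<iota> ` D)"
    using assms inf by (intro bij_betw_from_nat_into) (auto intro: countable_subset)
  moreover have "bij_betw (to_nat_on (- D)) (- D) UNIV"
    using assms(4) by (intro to_nat_on_infinite) (auto simp: finite_compl)
  ultimately have "bij_betw (from_nat_into (H - \<iota> ` D) \<circ> to_nat_on (- D)) (- D) (H - \<iota> ` D)"
    by (rule bij_betw_trans[rotated])
  then obtain \<gamma> where \<gamma>: "bij_betw \<gamma> (- D) (H - \<iota> ` D)" by blast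
  define \<beta> where "\<beta> n = (if n \<in> D then \<iota> n else \<gamma> n)" for n
  have "bij_betw \<beta> D (\<iota> ` D)"
    using assms(1) by (auto simp: bij_betw_def \<beta>_def inj_on_def)
  moreover have "bij_betw \<beta> (- D) (H - \<iota> ` D)"
    using \<gamma> by (subst bij_betw_cong[of _ \<beta> \<gamma>]) (auto simp: \<beta>_def)
  ultimately have "bij_betw \<beta> (D \<union> - D) (\<iota> ` D \<union> (H - \<iota> ` D))"
    by (intro bij_betw_combine) auto
  moreover have "\<iota> ` D \<union> (H - \<iota> ` D) = H" using assms(2) by auto
  ultimately show ?thesis by (intro exI[of _ \<beta>]) (auto simp: \<beta>_def)
qed

lemma enumerate_subgroup:
  assumes "group W" "subgroup H W" and \<beta>: "bij_betw \<beta> UNIV H"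
  obtains p where "p \<in> enumerated_groups" "\<beta> \<in> hom (group_of_ops p) W"
    "\<And>a. \<beta> (fst (snd p) a) = inv\<^bsub>W\<^esub> \<beta> a"
proof -
  interpret W: group W by fact
  interpret H: subgroup H W by fact
  define \<beta>i where "\<beta>i = inv_into UNIV \<beta>"
  have \<beta>i: "\<beta> (\<beta>i y) = y" if "y \<in> H" for y
    using \<beta> that by (auto simp: \<beta>i_def bij_betw_def f_inv_into_f)
  have \<beta>H: "\<beta> a \<in> H" for a using \<beta> by (auto simp: bij_betw_def)
  have inj: "\<beta> a = \<beta> c \<Longrightarrow> a = c" for a c using \<beta> by (auto simp: bij_betw_def inj_def)
  define p :: group_ops where
    "p = ((\<lambda>(a, c). \<beta>i (\<beta> a \<otimes>\<^bsub>W\<^esub> \<beta> c)), (\<lambda>a. \<beta>i (inv\<^bsub>W\<^esub> \<beta> a)), \<beta>i \<one>\<^bsub>W\<^esub>)"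
  have mult: "\<beta> (fst p (a, c)) = \<beta> a \<otimes>\<^bsub>W\<^esub> \<beta> c" for a c by (simp add: p_def \<beta>i \<beta>H)
  have inv: "\<beta> (fst (snd p) a) = inv\<^bsub>W\<^esub> \<beta> a" for a by (simp add: p_def \<beta>i \<beta>H)
  have one: "\<beta> (snd (snd p)) = \<one>\<^bsub>W\<^esub>" by (simp add: p_def \<beta>i)
  have carr: "\<beta> a \<in> carrier W" for a using \<beta>H by (rule H.mem_carrier)
  have group: "group (group_of_ops p)"
  proof (rule groupI)
    fix a c d
    show "a \<otimes>\<^bsub>group_of_ops p\<^esub> c \<otimes>\<^bsub>group_of_ops p\<^esub> d = a \<otimes>\<^bsub>group_of_ops p\<^esub> (c \<otimes>\<^bsub>group_of_ops p\<^esub> d)"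
      by (rule inj) (simp add: mult carr W.m_assoc)
    show "\<one>\<^bsub>group_of_ops p\<^esub> \<otimes>\<^bsub>group_of_ops p\<^esub> a = a" by (rule inj) (simp add: mult one carr)
    have "fst (snd p) a \<otimes>\<^bsub>group_of_ops p\<^esub> a = \<one>\<^bsub>group_of_ops p\<^esub>"
      by (rule inj) (simp add: mult one inv carr)
    then show "\<exists>b\<in>carrier (group_of_ops p). b \<otimes>\<^bsub>group_of_ops p\<^esub> a = \<one>\<^bsub>group_of_ops p\<^esub>" by auto
  qed simp_all
  have "fst (snd p) a = inv\<^bsub>group_of_ops p\<^esub> a" for a
  proof (rule group.inv_equality[OF group, symmetric])
    show "fst (snd p) a \<otimes>\<^bsub>group_of_ops p\<^esub> a = \<one>\<^bsub>group_of_ops p\<^esub>"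
      by (rule inj) (simp add: mult one inv carr)
  qed simp_all
  then have "p \<in> enumerated_groups" using group by (cases p) (simp add: enumerated_groups_def)
  moreover have "\<beta> \<in> hom (group_of_ops p) W" by (rule homI) (simp_all add: mult carr)
  ultimately show thesis using inv by (rule that)
qed

lemma smooth_obstruction_reflect:
  assumes "group G" "group W" "\<beta> \<in> hom G W" "inj_on \<beta> (carrier G)"
    and "{g, v, x, b, f} \<subseteq> carrier G"
    and "smooth_obstruction W (\<beta> g) (\<beta> v) (\<beta> x) (\<beta> b) (\<beta> f)"
  shows "smooth_obstruction G g v x b f"
proof -
  interpret \<beta>: group_hom G W \<beta> using assms(1-3) by (simp add: group_hom_def group_hom_axioms_def)
  have inj: "a = c" if "\<beta> a = \<beta> c" "a \<in> carrier G" "c \<in> carrier G" for a c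
    using assms(4) that by (auto dest: inj_onD)
  show ?thesis
    using assms(5,6) unfolding smooth_obstruction_def
    by (intro conjI; intro inj) (simp_all add: \<beta>.hom_nat_pow)
qed

text \<open>
  A basic neighbourhood of \<open>p\<close> constrains only the identity and the products and inverses of a finite
  set \<open>D\<close> of labels.
  Inside an extension of \<open>p\<close> in which \<open>g\<close> is obstructed, the countable subgroup generated by \<open>p\<close> and the witnesses
  is enumerated such that all labels occurring in these constraints, as well as \<open>g\<close>, are kept.
\<close>

lemma obstruction_dense:
  assumes p: "p \<in> li_enumerated_groups" and V: "open V" "p \<in> V"
  shows "\<exists>p'\<in>li_enumerated_groups \<inter> V. \<exists>v x b f. smooth_obstruction (group_of_ops p') g v x b f"
proof -
  obtain m i e where mie: "p = (m, i, e)" by (rule prod_cases3)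
  let ?G = "group_of_ops p"
  have G: "group ?G" "locally_indicable ?G" and i: "i a = inv\<^bsub>?G\<^esub> a" for a
    using p by (auto simp: li_enumerated_groups_def enumerated_groups_def mie)
  obtain D where D: "finite D"
    "\<And>m' i'. (\<forall>a\<in>D. \<forall>b\<in>D. m' (a, b) = m (a, b)) \<Longrightarrow> (\<forall>a\<in>D. i' a = i a) \<Longrightarrow> (m', i', e) \<in> V"
    using open_group_ops_finite_support[of V m i e] V mie by metis
  obtain \<iota> v x b f where W: "group (wreath ?G rational_wreath)"
      "locally_indicable (wreath ?G rational_wreath)"
    and \<iota>: "\<iota> \<in> hom ?G (wreath ?G rational_wreath)" "inj \<iota>"
    and ob: "smooth_obstruction (wreath ?G rational_wreath) (\<iota> g) v x b f"
    using locally_indicable_extension_with_obstruction[OF G(1) _ G(2)] by (metis group_of_ops_simps(1))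
  let ?W = "wreath ?G rational_wreath"
  interpret W: group ?W by fact
  interpret \<iota>: group_hom ?G ?W \<iota> using G(1) W(1) \<iota>(1) by (simp add: group_hom_def group_hom_axioms_def)
  define H where "H = generate ?W (range \<iota> \<union> {v, x, b, f})"
  have H: "subgroup H ?W" unfolding H_def by (rule W.generate_is_subgroup) simp
  have gens: "range \<iota> \<union> {v, x, b, f} \<subseteq> H" by (auto simp: H_def intro: generate.incl)
  have countable: "countable H" unfolding H_def by (rule W.countable_generate) auto
  \<comment> \<open>Besides \<open>D\<close>, the labels of all products and inverses formed in it have to be kept.\<close>
  define D' where "D' = D \<union> m ` (D \<times> D) \<union> i ` D \<union> {e, g}"
  have "finite D'" using D(1) by (simp add: D'_def)
  have range: "range \<iota> \<subseteq> H" using gens by simp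
  obtain \<beta> where \<beta>: "bij_betw \<beta> UNIV H" "\<And>a. a \<in> D' \<Longrightarrow> \<beta> a = \<iota> a"
    using bij_betw_extending_finite[OF \<iota>(2) range countable \<open>finite D'\<close>] by blast
  obtain p' where p': "p' \<in> enumerated_groups" "\<beta> \<in> hom (group_of_ops p') ?W"
    "\<And>a. \<beta> (fst (snd p') a) = inv\<^bsub>?W\<^esub> \<beta> a"
    using enumerate_subgroup[OF W(1) H \<beta>(1)] by blast
  have inj: "inj \<beta>" using \<beta>(1) by (simp add: bij_betw_def)
  have G': "group (group_of_ops p')" using p'(1) by (auto simp: enumerated_groups_def)
  interpret \<beta>: group_hom "group_of_ops p'" ?W \<beta>
    using G' W(1) p'(2) by (simp add: group_hom_def group_hom_axioms_def)
  have "locally_indicable (group_of_ops p')"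
    using locally_indicable_if_embeds[OF G' W p'(2)] inj by (simp add: inj_def inj_on_def)
  then have li: "p' \<in> li_enumerated_groups" using p'(1) by (simp add: li_enumerated_groups_def)
  have mult: "fst p' (a, c) = m (a, c)" if "a \<in> D" "c \<in> D" for a c
  proof (rule injD[OF inj])
    have memb: "a \<in> D'" "c \<in> D'" "m (a, c) \<in> D'" using that by (auto simp: D'_def)
    have "\<beta> (fst p' (a, c)) = \<iota> a \<otimes>\<^bsub>?W\<^esub> \<iota> c"
      using \<beta>.hom_mult[of a c] memb \<beta>(2) by simp
    also have "\<dots> = \<iota> (m (a, c))" using \<iota>.hom_mult[of a c] by (simp add: mie)
    finally show "\<beta> (fst p' (a, c)) = \<beta> (m (a, c))" using memb \<beta>(2) by simp
  qed
  have inv: "fst (snd p') a = i a" if "a \<in> D" for a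
  proof (rule injD[OF inj])
    have memb: "a \<in> D'" "i a \<in> D'" using that by (auto simp: D'_def)
    show "\<beta> (fst (snd p') a) = \<beta> (i a)" using memb \<beta>(2) p'(3) \<iota>.hom_inv[of a] by (simp add: i)
  qed
  have one: "snd (snd p') = e"
  proof (rule injD[OF inj])
    show "\<beta> (snd (snd p')) = \<beta> e"
      using \<beta>.hom_one \<iota>.hom_one \<beta>(2)[of e] by (simp add: D'_def mie)
  qed
  have "(fst p', fst (snd p'), e) \<in> V" using mult inv by (intro D(2)) auto
  then have "p' \<in> V" using one by (metis prod.collapse)
  have "\<exists>a. \<beta> a = y" if "y \<in> H" for y
    using \<beta>(1) that by (metis bij_betw_def imageE)
  then obtain v' x' b' f' where "\<beta> v' = v" "\<beta> x' = x" "\<beta> b' = b" "\<beta> f' = f"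
    using gens by (metis Un_subset_iff insert_subset)
  then have "smooth_obstruction (group_of_ops p') g v' x' b' f'"
    using ob \<beta>(2)[of g] inj
    by (intro smooth_obstruction_reflect[OF G' W(1) p'(2)]) (auto simp: D'_def inj_on_def inj_def)
  then show ?thesis using li \<open>p' \<in> V\<close> by blast
qed

section \<open>Generic locally indicable groups\<close>

lemma comeager_obstruction:
  "comeager_in (top_of_set li_enumerated_groups)
     {p \<in> li_enumerated_groups. \<forall>g. \<exists>v x b f. smooth_obstruction (group_of_ops p) g v x b f}"
proof -
  let ?L = "li_enumerated_groups"
  let ?O = "\<lambda>g. {p. \<exists>v x b f. smooth_obstruction (group_of_ops p) g v x b f}"
  have "openin (top_of_set ?L) (?L \<inter> ?O g)" for g
    using open_smooth_obstruction by (auto simp: openin_open)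
  moreover have "Abstract_Topology.closure_of (top_of_set ?L) (?L \<inter> ?O g) = topspace (top_of_set ?L)" for g
  proof -
    have "p \<in> Abstract_Topology.closure_of (top_of_set ?L) (?L \<inter> ?O g)" if p: "p \<in> ?L" for p
      unfolding in_closure_of
    proof (intro conjI allI impI)
      fix T assume "p \<in> T \<and> openin (top_of_set ?L) T"
      then obtain V where V: "open V" "p \<in> V" "T = ?L \<inter> V" by (auto simp: openin_open)
      show "\<exists>y. y \<in> ?L \<inter> ?O g \<and> y \<in> T" using obstruction_dense[OF p V(1,2), of g] V(3) by blast
    qed (use p in simp)
    then show ?thesis
      using closure_of_subset_topspace[of "top_of_set ?L" "?L \<inter> ?O g"] by auto
  qed
  ultimately show ?thesis
    unfolding comeager_in_def by (intro conjI exI[of _ "\<lambda>g. ?L \<inter> ?O g"]) auto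
qed

theorem corollary1p3p4:
  shows "\<exists>X. X \<subseteq> li_enumerated_groups \<and>
    comeager_in (top_of_set li_enumerated_groups) X \<and>
    (\<forall>p\<in>X.
       \<not> biorderable (group_of_ops p) \<and>
       \<not> has_nontrivial_action_by (group_of_ops p) {0..1} (C1_diffeo_interval {0..1}) \<and>
       \<not> has_nontrivial_action_by (group_of_ops p) {0..<1} (C1_diffeo_interval {0..<1}) \<and>
       \<not> has_nontrivial_action_by (group_of_ops p) unit_circle C1_diffeo_circle)"
proof (intro exI conjI ballI)
  let ?X = "{p \<in> li_enumerated_groups. \<forall>g. \<exists>v x b f. smooth_obstruction (group_of_ops p) g v x b f}"
  show "?X \<subseteq> li_enumerated_groups" by blast
  show "comeager_in (top_of_set li_enumerated_groups) ?X" by (rule comeager_obstruction)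
  fix p assume p: "p \<in> ?X"
  let ?G = "group_of_ops p"
  have obstruction: "\<exists>v x b f. smooth_obstruction ?G g v x b f" for g using p by blast
  interpret group ?G
    using p by (auto simp: li_enumerated_groups_def enumerated_groups_def)
  show "\<not> biorderable ?G"
  proof -
    obtain g where "g \<noteq> \<one>\<^bsub>?G\<^esub>" using infinite_UNIV_nat by (metis n_not_Suc_n)
    then show ?thesis using obstruction[of g] biorderable_obstruction by auto
  qed
  show "\<not> has_nontrivial_action_by ?G {0..1} (C1_diffeo_interval {0..1})"
  proof
    assume "has_nontrivial_action_by ?G {0..1::real} (C1_diffeo_interval {0..1})"
    then obtain \<phi> g y where action: "group_action ?G {0..1::real} \<phi>"
      and C1: "\<And>g. g \<in> carrier ?G \<Longrightarrow> C1_diffeo_interval {0..1} (\<phi> g)"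
      and y: "y \<in> {0..1}" "\<phi> g y \<noteq> y"
      unfolding has_nontrivial_action_by_def by blast
    obtain v x b f where "smooth_obstruction ?G g v x b f" using obstruction by blast
    from obstruction_trivial_on_interval[OF action _ C1 _ _ this, of 0 y] y
    show False by (simp add: is_interval_cc)
  qed
  show "\<not> has_nontrivial_action_by ?G {0..<1} (C1_diffeo_interval {0..<1})"
  proof
    assume "has_nontrivial_action_by ?G {0..<1::real} (C1_diffeo_interval {0..<1})"
    then obtain \<phi> g y where action: "group_action ?G {0..<1::real} \<phi>"
      and C1: "\<And>g. g \<in> carrier ?G \<Longrightarrow> C1_diffeo_interval {0..<1} (\<phi> g)"
      and y: "y \<in> {0..<1}" "\<phi> g y \<noteq> y"
      unfolding has_nontrivial_action_by_def by blast
    obtain v x b f where "smooth_obstruction ?G g v x b f" using obstruction by blast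
    from obstruction_trivial_on_interval[OF action _ C1 _ _ this, of 0 y] y
    show False by (simp add: is_interval_co)
  qed
  show "\<not> has_nontrivial_action_by ?G unit_circle C1_diffeo_circle"
  proof
    assume "has_nontrivial_action_by ?G unit_circle C1_diffeo_circle"
    then obtain \<phi> g y where action: "group_action ?G unit_circle \<phi>"
      and C1: "\<And>g. g \<in> carrier ?G \<Longrightarrow> C1_diffeo_circle (\<phi> g)"
      and y: "y \<in> unit_circle" "\<phi> g y \<noteq> y"
      unfolding has_nontrivial_action_by_def by blast
    obtain v x b f where "smooth_obstruction ?G g v x b f" using obstruction by blast
    from obstruction_trivial_on_circle[OF action C1 this _ _ _ _ _ y(1)] y(2)
    show False by simp
  qed
qed

end
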